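(* Let $U$ and $V$ be two vector spaces over $\mathbb{K}$ in duality via a bilinear form $\langle\cdot,\cdot\rangle: U\times V\to\mathbb{K}$. Then there exists one and only one Laplace pairing $(\cdot|\cdot)$ on the joint tensor algebra $\mathcal{T}(U,V)=\mathcal{T}(U)\otimes\mathcal{T}(V)$ that is compatible with the duality. Moreover, it is symmetric: $(a|b)=(b|a)$ for all $a,b\in\mathcal{T}(U)\otimes\mathcal{T}(V)$.
   Context: $\mathbb{K}$ is $\mathbb{R}$ or $\mathbb{C}$. $\mathcal{T}(U)=\bigoplus_{n\ge 0}\bigotimes^n U$ (with $\bigotimes^0U=\mathbb{K}$) is the tensor algebra with concatenation product. It is a Hopf algebra whose co-multiplication $\Delta$ is the algebra homomorphism determined by $\Delta(\mathbf{1})=\mathbf{1}\otimes\mathbf{1}$, $\Delta(x)=\mathbf{1}\otimes x+x\otimes\mathbf{1}$ for $x\in U$; the same applies to $\mathcal{T}(V)$. The joint tensor algebra $\mathcal{T}(U,V)=\mathcal{T}(U)\otimes\mathcal{T}(V)$ is the tensor product of these Hopf algebras: its product is $(u_1\otimes v_1)\cdot(u_2\otimes v_2)=(u_1\cdot u_2)\otimes(v_1\cdot v_2)$, its unit is $\mathbf{1}=1\otimes 1$, and its co-multiplication is $u\otimes v\mapsto\sum_{(u),(v)}(u_{(1)}\otimes v_{(1)})\otimes(u_{(2)}\otimes v_{(2)})$. Sweedler notation $\sum_{(a)}a_{(1)}\otimes a_{(2)}$ is used for the co-multiplication of $a$. A Laplace pairing on $\mathcal{T}(U,V)$ is a symmetric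 bilinear form $(\cdot|\cdot)$ with values in $\mathbb{K}$ satisfying $(a|bc)=\sum_{(a)}(a_{(1)}|b)(a_{(2)}|c)$ for all $a,b,c\in\mathcal{T}(U,V)$. It is compatible with the duality if: (i) $(\mathbf{1}|\mathbf{1})=1$; (ii) $(1\otimes y|x\otimes 1)=(x\otimes 1|1\otimes y)=\langle x,y\rangle$ for $x\in U$, $y\in V$; (iii) $(x_1\otimes 1|x_2\otimes 1)=(1\otimes y_1|1\otimes y_2)=0$ for $x_1,x_2\in U$, $y_1,y_2\in V$; (iv) $(x\otimes 1|1\otimes 1)=(1\otimes 1|x\otimes 1)=(1\otimes 1|1\otimes y)=(1\otimes y|1\otimes 1)=0$ for $x\in U$, $y\in V$. *)

theory Defs
  imports Complex_Main "HOL-Library.Poly_Mapping" "HOL-Algebra.Module"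
begin

text \<open>
  The vector spaces \<open>U\<close> and \<open>V\<close> are whole types with an explicit scalar multiplication
  (locale \<^locale>\<open>vector_space\<close>).  A quotient by relations that depend on such a scalar
  multiplication cannot be a type, so all spaces built from them are \<open>'k\<close>-algebras given by a
  record with an explicit carrier (the record \<open>module\<close> of HOL-Algebra, which has the ring
  operations and the scalar multiplication).  Their elements are cosets in a free vector space
  \<open>'x \<Rightarrow>\<^sub>0 'k\<close>.
\<close>

subsection \<open>Quotients of free vector spaces\<close>

definition fscale :: "'k::field \<Rightarrow> ('x \<Rightarrow>\<^sub>0 'k) \<Rightarrow> ('x \<Rightarrow>\<^sub>0 'k)" where
  "fscale c p = Poly_Mapping.map (\<lambda>d. c * d) p"

definition fspan :: "('x \<Rightarrow>\<^sub>0 'k::field) set \<Rightarrow> ('x \<Rightarrow>\<^sub>0 'k) set" where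
  "fspan R = module.span fscale R"

definition coset_of :: "('x \<Rightarrow>\<^sub>0 'k::field) set \<Rightarrow> ('x \<Rightarrow>\<^sub>0 'k) \<Rightarrow> ('x \<Rightarrow>\<^sub>0 'k) set" where
  "coset_of N p = {q. q - p \<in> N}"

definition rep :: "('x \<Rightarrow>\<^sub>0 'k::field) set \<Rightarrow> ('x \<Rightarrow>\<^sub>0 'k)" where
  "rep X = (SOME p. p \<in> X)"

text \<open>Bilinear extension of a binary operation \<open>m\<close> on the basis to the free vector space.\<close>

definition fmult ::
  "('x \<Rightarrow> 'x \<Rightarrow> 'x) \<Rightarrow> ('x \<Rightarrow>\<^sub>0 'k::field) \<Rightarrow> ('x \<Rightarrow>\<^sub>0 'k) \<Rightarrow> ('x \<Rightarrow>\<^sub>0 'k)" where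
  "fmult m p q =
     (\<Sum>x\<in>Poly_Mapping.keys p. \<Sum>y\<in>Poly_Mapping.keys q.
        Poly_Mapping.single (m x y) (Poly_Mapping.lookup p x * Poly_Mapping.lookup q y))"

text \<open>
  The monoid algebra of \<open>(S, m, e)\<close> modulo \<open>N\<close>.  In the instances below \<open>N\<close> is a two-sided ideal
  contained in the free vector space on \<open>S\<close>, so the operations do not depend on the
  representatives chosen by \<^const>\<open>rep\<close>.
\<close>

definition quot_algebra ::
  "'x set \<Rightarrow> ('x \<Rightarrow> 'x \<Rightarrow> 'x) \<Rightarrow> 'x \<Rightarrow> ('x \<Rightarrow>\<^sub>0 'k::field) set
    \<Rightarrow> ('k, ('x \<Rightarrow>\<^sub>0 'k) set) module" where
  "quot_algebra S m e N =
     \<lparr>carrier = coset_of N ` {p. Poly_Mapping.keys p \<subseteq> S},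
      monoid.mult = (\<lambda>X Y. coset_of N (fmult m (rep X) (rep Y))),
      one = coset_of N (Poly_Mapping.single e 1),
      zero = coset_of N 0,
      add = (\<lambda>X Y. coset_of N (rep X + rep Y)),
      smult = (\<lambda>c X. coset_of N (fscale c (rep X)))\<rparr>"

text \<open>
  The linear map into \<open>M\<close> induced on a quotient of a free vector space by the values \<open>g\<close> on the
  basis; it is independent of the representative whenever \<open>g\<close> respects the relations.
\<close>

definition induced ::
  "('k::field, 'm) module \<Rightarrow> ('x \<Rightarrow> 'm) \<Rightarrow> ('x \<Rightarrow>\<^sub>0 'k) set \<Rightarrow> 'm" where
  "induced M g X =
     (\<Oplus>\<^bsub>M\<^esub>x\<in>Poly_Mapping.keys (rep X). Poly_Mapping.lookup (rep X) x \<odot>\<^bsub>M\<^esub> g x)"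

definition scalars :: "('k::field, 'k) module" where
  "scalars = \<lparr>carrier = UNIV, monoid.mult = (*), one = 1, zero = 0, add = (+), smult = (*)\<rparr>"


subsection \<open>Tensor product of algebras\<close>

definition tensor_rels ::
  "('k::field, 'a) module \<Rightarrow> ('k, 'b) module \<Rightarrow> ('a \<times> 'b \<Rightarrow>\<^sub>0 'k) set" where
  "tensor_rels A B = fspan (
     {Poly_Mapping.single (a \<oplus>\<^bsub>A\<^esub> a', b) 1 - Poly_Mapping.single (a, b) 1 - Poly_Mapping.single (a', b) 1
        | a a' b. a \<in> carrier A \<and> a' \<in> carrier A \<and> b \<in> carrier B} \<union>
     {Poly_Mapping.single (a, b \<oplus>\<^bsub>B\<^esub> b') 1 - Poly_Mapping.single (a, b) 1 - Poly_Mapping.single (a, b') 1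
        | a b b'. a \<in> carrier A \<and> b \<in> carrier B \<and> b' \<in> carrier B} \<union>
     {Poly_Mapping.single (c \<odot>\<^bsub>A\<^esub> a, b) 1 - Poly_Mapping.single (a, b) c
        | c a b. a \<in> carrier A \<and> b \<in> carrier B} \<union>
     {Poly_Mapping.single (a, c \<odot>\<^bsub>B\<^esub> b) 1 - Poly_Mapping.single (a, b) c
        | c a b. a \<in> carrier A \<and> b \<in> carrier B})"

definition tensor_alg ::
  "('k::field, 'a) module \<Rightarrow> ('k, 'b) module \<Rightarrow> ('k, ('a \<times> 'b \<Rightarrow>\<^sub>0 'k) set) module" where
  "tensor_alg A B =
     quot_algebra (carrier A \<times> carrier B)
       (\<lambda>(a, b) (a', b'). (a \<otimes>\<^bsub>A\<^esub> a', b \<otimes>\<^bsub>B\<^esub> b')) (\<one>\<^bsub>A\<^esub>, \<one>\<^bsub>B\<^esub>) (tensor_rels A B)"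

definition tensor ::
  "('k::field, 'a) module \<Rightarrow> ('k, 'b) module \<Rightarrow> 'a \<Rightarrow> 'b \<Rightarrow> ('a \<times> 'b \<Rightarrow>\<^sub>0 'k) set" where
  "tensor A B a b = coset_of (tensor_rels A B) (Poly_Mapping.single (a, b) 1)"

text \<open>
  \<open>sweedler M f t\<close> is \<open>\<Sum> f t\<^sub>(\<^sub>1\<^sub>) t\<^sub>(\<^sub>2\<^sub>)\<close> for \<open>t = \<Sum> t\<^sub>(\<^sub>1\<^sub>) \<otimes> t\<^sub>(\<^sub>2\<^sub>)\<close> and a bilinear \<open>f\<close> with values in \<open>M\<close>.
\<close>

definition sweedler ::
  "('k::field, 'm) module \<Rightarrow> ('a \<Rightarrow> 'b \<Rightarrow> 'm) \<Rightarrow> ('a \<times> 'b \<Rightarrow>\<^sub>0 'k) set \<Rightarrow> 'm" where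
  "sweedler M f t = induced M (\<lambda>(a, b). f a b) t"


subsection \<open>The tensor algebra of a vector space\<close>

text \<open>
  The word \<open>[x\<^sub>1, \<dots>, x\<^sub>n]\<close> stands for \<open>x\<^sub>1 \<otimes> \<dots> \<otimes> x\<^sub>n\<close>.  Every relation involves words of one length
  only, so the quotient is the direct sum over \<open>n\<close> of the free vector space on words of length \<open>n\<close>
  modulo multilinearity, that is, of the \<open>n\<close>-th tensor powers; the empty word spans the
  component of degree 0.
\<close>

definition word_rels :: "('k::field \<Rightarrow> 'u::ab_group_add \<Rightarrow> 'u) \<Rightarrow> ('u list \<Rightarrow>\<^sub>0 'k) set" where
  "word_rels s = fspan (
     {Poly_Mapping.single (w @ [x + y] @ w') 1 - Poly_Mapping.single (w @ [x] @ w') 1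
        - Poly_Mapping.single (w @ [y] @ w') 1 | w x y w'. True} \<union>
     {Poly_Mapping.single (w @ [s c x] @ w') 1 - Poly_Mapping.single (w @ [x] @ w') c
        | w c x w'. True})"

definition tensor_algebra ::
  "('k::field \<Rightarrow> 'u::ab_group_add \<Rightarrow> 'u) \<Rightarrow> ('k, ('u list \<Rightarrow>\<^sub>0 'k) set) module" where
  "tensor_algebra s = quot_algebra UNIV (@) [] (word_rels s)"

definition gen :: "('k::field \<Rightarrow> 'u::ab_group_add \<Rightarrow> 'u) \<Rightarrow> 'u \<Rightarrow> ('u list \<Rightarrow>\<^sub>0 'k) set" where
  "gen s x = coset_of (word_rels s) (Poly_Mapping.single [x] 1)"

text \<open>The algebra homomorphism from the tensor algebra to \<open>A\<close> that extends a linear map \<open>f\<close>.\<close>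

definition hom_ext ::
  "('k::field, 'a) module \<Rightarrow> ('u \<Rightarrow> 'a) \<Rightarrow> ('u list \<Rightarrow>\<^sub>0 'k) set \<Rightarrow> 'a" where
  "hom_ext A f = induced A (\<lambda>w. foldr (\<lambda>x a. f x \<otimes>\<^bsub>A\<^esub> a) w \<one>\<^bsub>A\<^esub>)"

definition comult_T ::
  "('k::field \<Rightarrow> 'u::ab_group_add \<Rightarrow> 'u) \<Rightarrow> ('u list \<Rightarrow>\<^sub>0 'k) set
    \<Rightarrow> (('u list \<Rightarrow>\<^sub>0 'k) set \<times> ('u list \<Rightarrow>\<^sub>0 'k) set \<Rightarrow>\<^sub>0 'k) set" where
  "comult_T s =
     (let T = tensor_algebra s; TT = tensor_alg T T
      in hom_ext TT (\<lambda>x. tensor T T \<one>\<^bsub>T\<^esub> (gen s x) \<oplus>\<^bsub>TT\<^esub> tensor T T (gen s x) \<one>\<^bsub>T\<^esub>))"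


subsection \<open>The joint tensor algebra\<close>

type_synonym ('k, 'u, 'v) joint = "(('u list \<Rightarrow>\<^sub>0 'k) set \<times> ('v list \<Rightarrow>\<^sub>0 'k) set \<Rightarrow>\<^sub>0 'k) set"

definition joint_algebra ::
  "('k::field \<Rightarrow> 'u::ab_group_add \<Rightarrow> 'u) \<Rightarrow> ('k \<Rightarrow> 'v::ab_group_add \<Rightarrow> 'v)
    \<Rightarrow> ('k, ('k, 'u, 'v) joint) module" where
  "joint_algebra sU sV = tensor_alg (tensor_algebra sU) (tensor_algebra sV)"

definition joint_tensor ::
  "('k::field \<Rightarrow> 'u::ab_group_add \<Rightarrow> 'u) \<Rightarrow> ('k \<Rightarrow> 'v::ab_group_add \<Rightarrow> 'v)
    \<Rightarrow> ('u list \<Rightarrow>\<^sub>0 'k) set \<Rightarrow> ('v list \<Rightarrow>\<^sub>0 'k) set \<Rightarrow> ('k, 'u, 'v) joint" where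
  "joint_tensor sU sV = tensor (tensor_algebra sU) (tensor_algebra sV)"

definition comult_joint ::
  "('k::field \<Rightarrow> 'u::ab_group_add \<Rightarrow> 'u) \<Rightarrow> ('k \<Rightarrow> 'v::ab_group_add \<Rightarrow> 'v)
    \<Rightarrow> ('k, 'u, 'v) joint \<Rightarrow> (('k, 'u, 'v) joint \<times> ('k, 'u, 'v) joint \<Rightarrow>\<^sub>0 'k) set" where
  "comult_joint sU sV =
     (let H = joint_algebra sU sV; HH = tensor_alg H H; t = joint_tensor sU sV
      in sweedler HH
           (\<lambda>u v. sweedler HH
              (\<lambda>u1 u2. sweedler HH
                 (\<lambda>v1 v2. tensor H H (t u1 v1) (t u2 v2)) (comult_T sV v)) (comult_T sU u)))"

definition emb_U ::
  "('k::field \<Rightarrow> 'u::ab_group_add \<Rightarrow> 'u) \<Rightarrow> ('k \<Rightarrow> 'v::ab_group_add \<Rightarrow> 'v) \<Rightarrow> 'u \<Rightarrow> ('k, 'u, 'v) joint" where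
  "emb_U sU sV x = joint_tensor sU sV (gen sU x) \<one>\<^bsub>tensor_algebra sV\<^esub>"

definition emb_V ::
  "('k::field \<Rightarrow> 'u::ab_group_add \<Rightarrow> 'u) \<Rightarrow> ('k \<Rightarrow> 'v::ab_group_add \<Rightarrow> 'v) \<Rightarrow> 'v \<Rightarrow> ('k, 'u, 'v) joint" where
  "emb_V sU sV y = joint_tensor sU sV \<one>\<^bsub>tensor_algebra sU\<^esub> (gen sV y)"


subsection \<open>Laplace pairings\<close>

text \<open>
  A bilinear form on \<open>A\<close> is a function on pairs that is extensional outside
  \<open>carrier A \<times> carrier A\<close>, so that equality of forms is equality on the carrier.
\<close>

definition bilinear_form :: "('k::field, 'a) module \<Rightarrow> ('a \<times> 'a \<Rightarrow> 'k) \<Rightarrow> bool" where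
  "bilinear_form A P \<longleftrightarrow>
     P \<in> extensional (carrier A \<times> carrier A) \<and>
     (\<forall>a\<in>carrier A. \<forall>a'\<in>carrier A. \<forall>b\<in>carrier A.
        P (a \<oplus>\<^bsub>A\<^esub> a', b) = P (a, b) + P (a', b) \<and> P (b, a \<oplus>\<^bsub>A\<^esub> a') = P (b, a) + P (b, a')) \<and>
     (\<forall>c. \<forall>a\<in>carrier A. \<forall>b\<in>carrier A.
        P (c \<odot>\<^bsub>A\<^esub> a, b) = c * P (a, b) \<and> P (a, c \<odot>\<^bsub>A\<^esub> b) = c * P (a, b))"

definition symmetric_form :: "('k::field, 'a) module \<Rightarrow> ('a \<times> 'a \<Rightarrow> 'k) \<Rightarrow> bool" where
  "symmetric_form A P \<longleftrightarrow> (\<forall>a\<in>carrier A. \<forall>b\<in>carrier A. P (a, b) = P (b, a))"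

definition laplace_pairing ::
  "('k::field \<Rightarrow> 'u::ab_group_add \<Rightarrow> 'u) \<Rightarrow> ('k \<Rightarrow> 'v::ab_group_add \<Rightarrow> 'v)
    \<Rightarrow> (('k, 'u, 'v) joint \<times> ('k, 'u, 'v) joint \<Rightarrow> 'k) \<Rightarrow> bool" where
  "laplace_pairing sU sV P \<longleftrightarrow>
     (let H = joint_algebra sU sV
      in bilinear_form H P \<and> symmetric_form H P \<and>
         (\<forall>a\<in>carrier H. \<forall>b\<in>carrier H. \<forall>c\<in>carrier H.
            P (a, b \<otimes>\<^bsub>H\<^esub> c) =
              sweedler scalars (\<lambda>a1 a2. P (a1, b) * P (a2, c)) (comult_joint sU sV a)))"

definition compatible_with ::
  "('k::field \<Rightarrow> 'u::ab_group_add \<Rightarrow> 'u) \<Rightarrow> ('k \<Rightarrow> 'v::ab_group_add \<Rightarrow> 'v) \<Rightarrow> ('u \<Rightarrow> 'v \<Rightarrow> 'k)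
    \<Rightarrow> (('k, 'u, 'v) joint \<times> ('k, 'u, 'v) joint \<Rightarrow> 'k) \<Rightarrow> bool" where
  "compatible_with sU sV d P \<longleftrightarrow>
     (let unit = \<one>\<^bsub>joint_algebra sU sV\<^esub>; i = emb_U sU sV; j = emb_V sU sV
      in P (unit, unit) = 1 \<and>
         (\<forall>x y. P (j y, i x) = d x y \<and> P (i x, j y) = d x y) \<and>
         (\<forall>x1 x2. P (i x1, i x2) = 0) \<and>
         (\<forall>y1 y2. P (j y1, j y2) = 0) \<and>
         (\<forall>x. P (i x, unit) = 0 \<and> P (unit, i x) = 0) \<and>
         (\<forall>y. P (unit, j y) = 0 \<and> P (j y, unit) = 0))"

end

theory Submission
  imports Defs
begin

text \<open>The pairing is a product of permanents.  For words \<open>u = x\<^sub>1 \<dots> x\<^sub>n\<close> in \<open>U\<close> and \<open>v = y\<^sub>1 \<dots> y\<^sub>m\<close>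
  in \<open>V\<close> let \<open>perm(u, v)\<close> be the permanent of the matrix of the \<open>\<langle>x\<^sub>i, y\<^sub>j\<rangle>\<close>, which is \<open>0\<close> unless
  \<open>n = m\<close>.  Then
  \<open>(u \<otimes> v | u' \<otimes> v') = perm(u, v') perm(u', v)\<close>, a formula that is visibly symmetric.

  Existence.  The comultiplication of a word is the sum over all ways to split it into two
  complementary subwords, because the letters are primitive (\<open>comult_T_word\<close>).  Therefore the
  identity \<open>(a|bc) = \<Sum> (a\<^sub>1|b)(a\<^sub>2|c)\<close>, evaluated on words, is the product of the two Laplace expansions
  of a permanent: along a block of columns (\<open>permanent_append_right\<close>) and along a block of rows
  (\<open>permanent_append_left\<close>).  The same expansions reduce multilinearity of the permanent to the
  case of a matrix with a single row or column.

  Uniqueness.  The joint algebra is spanned by products of the elements \<open>x \<otimes> 1\<close> and \<open>1 \<otimes> y\<close>,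
  which are primitive.  The Laplace identity with \<open>\<Delta>1 = 1 \<otimes> 1\<close> determines \<open>(1|b)\<close> on such products,
  with \<open>\<Delta>g = 1 \<otimes> g + g \<otimes> 1\<close> it determines \<open>(g|b)\<close> for every generator \<open>g\<close>, and by symmetry
  \<open>(ga|b) = (b|ga) = \<Sum> (b\<^sub>1|g)(b\<^sub>2|a)\<close> reduces every other value to these (\<open>laplace_pairing_unique\<close>).

  All spaces involved are quotients of free vector spaces in which operations are computed on chosen
  representatives.  The locale \<open>free_quotient\<close> settles once and for all that the choice is immaterial:
  it provides the algebra structure and the universal property of such a quotient.  The tensor
  algebra and tensor products are its two instances, and what they pass on to the later sections
  is their universal property together with an induction rule that reduces linear statements to
  words and pure tensors.\<close>

section \<open>Free vector spaces\<close>

lemma lookup_fscale [simp]: "Poly_Mapping.lookup (fscale c p) x = c * Poly_Mapping.lookup p x"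
  by (simp add: fscale_def Poly_Mapping.map.rep_eq when_def)

interpretation fv: vector_space "fscale :: 'k::field \<Rightarrow> ('x \<Rightarrow>\<^sub>0 'k) \<Rightarrow> ('x \<Rightarrow>\<^sub>0 'k)"
  by unfold_locales (auto intro!: poly_mapping_eqI simp: lookup_add algebra_simps)

lemma fscale_single [simp]: "fscale c (Poly_Mapping.single x d) = Poly_Mapping.single x (c * d)"
  by (rule poly_mapping_eqI) (simp add: lookup_single when_def)

definition free :: "'x set \<Rightarrow> ('x \<Rightarrow>\<^sub>0 'k::field) set" where
  "free S = {p. Poly_Mapping.keys p \<subseteq> S}"

lemma free_subspace: "fv.subspace (free S :: ('x \<Rightarrow>\<^sub>0 'k::field) set)"
proof (rule fv.subspaceI)
  show "(0 :: 'x \<Rightarrow>\<^sub>0 'k) \<in> free S" by (simp add: free_def)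
next
  fix p q :: "'x \<Rightarrow>\<^sub>0 'k" assume "p \<in> free S" "q \<in> free S"
  then show "p + q \<in> free S" using Poly_Mapping.keys_add[of p q] by (auto simp: free_def)
next
  fix c and p :: "'x \<Rightarrow>\<^sub>0 'k" assume "p \<in> free S"
  then show "fscale c p \<in> free S" by (auto simp: free_def in_keys_iff)
qed

lemmas free_add = fv.subspace_add[OF free_subspace]
  and free_diff = fv.subspace_diff[OF free_subspace]
  and free_scale = fv.subspace_scale[OF free_subspace]
  and free_sum = fv.subspace_sum[OF free_subspace]
  and free_zero = fv.subspace_0[OF free_subspace]

lemma free_single: "x \<in> S \<Longrightarrow> Poly_Mapping.single x c \<in> free S"
  by (auto simp: free_def)

lemma free_UNIV [simp]: "free UNIV = UNIV"
  by (simp add: free_def)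

lemma sum_singles:
  "p = (\<Sum>x\<in>Poly_Mapping.keys p. Poly_Mapping.single x (Poly_Mapping.lookup p x))"
  by (rule poly_mapping_eqI)
     (simp add: Poly_Mapping.lookup_sum lookup_single when_def in_keys_iff)

lemma free_induct [consumes 1, case_names zero single add]:
  assumes p: "p \<in> free S"
    and zero: "Q 0"
    and single: "\<And>x c. x \<in> S \<Longrightarrow> Q (Poly_Mapping.single x c)"
    and add: "\<And>p q. p \<in> free S \<Longrightarrow> q \<in> free S \<Longrightarrow> Q p \<Longrightarrow> Q q \<Longrightarrow> Q (p + q)"
  shows "Q p"
proof -
  have "Q (\<Sum>x\<in>T. Poly_Mapping.single x (Poly_Mapping.lookup p x))" if "finite T" "T \<subseteq> S" for T
    using that
  proof (induction T)
    case (insert x T)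
    then show ?case
      by (auto intro!: add single free_single free_sum)
  qed (simp add: zero)
  from this[of "Poly_Mapping.keys p"] show ?thesis
    using p by (simp add: free_def flip: sum_singles)
qed

lemma scalars_simps [simp]:
  "carrier scalars = UNIV" "x \<oplus>\<^bsub>scalars\<^esub> y = x + y" "x \<otimes>\<^bsub>scalars\<^esub> y = x * y"
  "\<one>\<^bsub>scalars\<^esub> = 1" "\<zero>\<^bsub>scalars\<^esub> = 0" "c \<odot>\<^bsub>scalars\<^esub> x = c * x"
  by (simp_all add: scalars_def)

lemma cring_scalars: "cring (scalars :: ('k::field, 'k) module)"
proof (rule cringI)
  show "abelian_group (scalars :: ('k, 'k) module)"
  proof (rule abelian_groupI)
    fix x :: 'k
    show "\<exists>y\<in>carrier scalars. y \<oplus>\<^bsub>scalars\<^esub> x = \<zero>\<^bsub>scalars\<^esub>"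
      by (rule bexI[of _ "- x"]) simp_all
  qed (simp_all add: algebra_simps)
  show "Group.comm_monoid (scalars :: ('k, 'k) module)"
    by (rule comm_monoidI) (simp_all add: algebra_simps)
qed (simp add: algebra_simps)

abbreviation kspace :: "('k::field, 'm) module \<Rightarrow> bool" where
  "kspace M \<equiv> Module.module scalars M"

text \<open>Additive inverses come for free in a vector space: they are multiples by \<open>-1\<close>.\<close>

lemma kspaceI:
  assumes "\<And>x y. x \<in> carrier M \<Longrightarrow> y \<in> carrier M \<Longrightarrow> x \<oplus>\<^bsub>M\<^esub> y \<in> carrier M"
    and "\<zero>\<^bsub>M\<^esub> \<in> carrier M"
    and "\<And>x y z. x \<in> carrier M \<Longrightarrow> y \<in> carrier M \<Longrightarrow> z \<in> carrier M \<Longrightarrow>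
      (x \<oplus>\<^bsub>M\<^esub> y) \<oplus>\<^bsub>M\<^esub> z = x \<oplus>\<^bsub>M\<^esub> (y \<oplus>\<^bsub>M\<^esub> z)"
    and "\<And>x y. x \<in> carrier M \<Longrightarrow> y \<in> carrier M \<Longrightarrow> x \<oplus>\<^bsub>M\<^esub> y = y \<oplus>\<^bsub>M\<^esub> x"
    and "\<And>x. x \<in> carrier M \<Longrightarrow> \<zero>\<^bsub>M\<^esub> \<oplus>\<^bsub>M\<^esub> x = x"
    and closed: "\<And>c x. x \<in> carrier M \<Longrightarrow> c \<odot>\<^bsub>M\<^esub> x \<in> carrier M"
    and neg: "\<And>x. x \<in> carrier M \<Longrightarrow> (-1) \<odot>\<^bsub>M\<^esub> x \<oplus>\<^bsub>M\<^esub> x = \<zero>\<^bsub>M\<^esub>"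
    and "\<And>c d x. x \<in> carrier M \<Longrightarrow> (c + d) \<odot>\<^bsub>M\<^esub> x = c \<odot>\<^bsub>M\<^esub> x \<oplus>\<^bsub>M\<^esub> d \<odot>\<^bsub>M\<^esub> x"
    and "\<And>c x y. x \<in> carrier M \<Longrightarrow> y \<in> carrier M \<Longrightarrow>
      c \<odot>\<^bsub>M\<^esub> (x \<oplus>\<^bsub>M\<^esub> y) = c \<odot>\<^bsub>M\<^esub> x \<oplus>\<^bsub>M\<^esub> c \<odot>\<^bsub>M\<^esub> y"
    and "\<And>c d x. x \<in> carrier M \<Longrightarrow> (c * d) \<odot>\<^bsub>M\<^esub> x = c \<odot>\<^bsub>M\<^esub> (d \<odot>\<^bsub>M\<^esub> x)"
    and "\<And>x. x \<in> carrier M \<Longrightarrow> 1 \<odot>\<^bsub>M\<^esub> x = x"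
  shows "kspace (M :: ('k::field, 'm) module)"
proof (rule moduleI[OF cring_scalars])
  show "abelian_group M"
  proof (rule abelian_groupI)
    fix x assume "x \<in> carrier M"
    then show "\<exists>y\<in>carrier M. y \<oplus>\<^bsub>M\<^esub> x = \<zero>\<^bsub>M\<^esub>"
      by (intro bexI[of _ "(-1) \<odot>\<^bsub>M\<^esub> x"] neg closed)
  qed (use assms in auto)
qed (use assms in auto)

lemma kspace_scalars: "kspace (scalars :: ('k::field, 'k) module)"
  by (rule kspaceI) (simp_all add: algebra_simps)

section \<open>Linear maps out of a free vector space\<close>

text \<open>The linear extension of \<open>g\<close> to the free vector space; \<^const>\<open>induced\<close> is this map applied to a
  representative of a coset.\<close>

definition lext :: "('k::field, 'm) module \<Rightarrow> ('x \<Rightarrow> 'm) \<Rightarrow> ('x \<Rightarrow>\<^sub>0 'k) \<Rightarrow> 'm" where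
  "lext M g p = (\<Oplus>\<^bsub>M\<^esub>x\<in>Poly_Mapping.keys p. Poly_Mapping.lookup p x \<odot>\<^bsub>M\<^esub> g x)"

definition linmap :: "('k::field, 'a) module \<Rightarrow> ('k, 'b) module \<Rightarrow> ('a \<Rightarrow> 'b) \<Rightarrow> bool" where
  "linmap A B f \<longleftrightarrow> f \<in> carrier A \<rightarrow> carrier B \<and>
     (\<forall>x\<in>carrier A. \<forall>y\<in>carrier A. f (x \<oplus>\<^bsub>A\<^esub> y) = f x \<oplus>\<^bsub>B\<^esub> f y) \<and>
     (\<forall>c. \<forall>x\<in>carrier A. f (c \<odot>\<^bsub>A\<^esub> x) = c \<odot>\<^bsub>B\<^esub> f x)"

lemma linmapI:
  assumes "\<And>x. x \<in> carrier A \<Longrightarrow> f x \<in> carrier B"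
    and "\<And>x y. x \<in> carrier A \<Longrightarrow> y \<in> carrier A \<Longrightarrow> f (x \<oplus>\<^bsub>A\<^esub> y) = f x \<oplus>\<^bsub>B\<^esub> f y"
    and "\<And>c x. x \<in> carrier A \<Longrightarrow> f (c \<odot>\<^bsub>A\<^esub> x) = c \<odot>\<^bsub>B\<^esub> f x"
  shows "linmap A B f"
  using assms by (auto simp: linmap_def)

lemma
  assumes "linmap A B f"
  shows linmap_closed: "x \<in> carrier A \<Longrightarrow> f x \<in> carrier B"
    and linmap_add: "x \<in> carrier A \<Longrightarrow> y \<in> carrier A \<Longrightarrow> f (x \<oplus>\<^bsub>A\<^esub> y) = f x \<oplus>\<^bsub>B\<^esub> f y"
    and linmap_smult: "x \<in> carrier A \<Longrightarrow> f (c \<odot>\<^bsub>A\<^esub> x) = c \<odot>\<^bsub>B\<^esub> f x"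
  using assms by (auto simp: linmap_def)

context
  fixes M :: "('k::field, 'm) module"
  assumes M: "kspace M"
begin

interpretation M: Module.module scalars M by (rule M)

lemma kspace_simps:
  "x \<in> carrier M \<Longrightarrow> c \<odot>\<^bsub>M\<^esub> x \<in> carrier M"
  "x \<in> carrier M \<Longrightarrow> 0 \<odot>\<^bsub>M\<^esub> x = \<zero>\<^bsub>M\<^esub>"
  "x \<in> carrier M \<Longrightarrow> 1 \<odot>\<^bsub>M\<^esub> x = x"
  "c \<odot>\<^bsub>M\<^esub> \<zero>\<^bsub>M\<^esub> = \<zero>\<^bsub>M\<^esub>"
  "x \<in> carrier M \<Longrightarrow> (c + d) \<odot>\<^bsub>M\<^esub> x = c \<odot>\<^bsub>M\<^esub> x \<oplus>\<^bsub>M\<^esub> d \<odot>\<^bsub>M\<^esub> x"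
  "x \<in> carrier M \<Longrightarrow> y \<in> carrier M \<Longrightarrow> c \<odot>\<^bsub>M\<^esub> (x \<oplus>\<^bsub>M\<^esub> y) = c \<odot>\<^bsub>M\<^esub> x \<oplus>\<^bsub>M\<^esub> c \<odot>\<^bsub>M\<^esub> y"
  "x \<in> carrier M \<Longrightarrow> (c * d) \<odot>\<^bsub>M\<^esub> x = c \<odot>\<^bsub>M\<^esub> (d \<odot>\<^bsub>M\<^esub> x)"
  using M.smult_closed[of c x] M.smult_l_null[of x] M.smult_one[of x] M.smult_r_null[of c]
    M.smult_l_distr[of c d x] M.smult_r_distr[of c x y] M.smult_assoc1[of c d x]
  by simp_all

text \<open>Sums of formal combinations have to be compared over one common index set, since the set of keys
  of \<open>p + q\<close> depends on cancellations.\<close>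

lemma lext_superset:
  assumes g: "g \<in> T \<rightarrow> carrier M" and T: "finite T" "Poly_Mapping.keys p \<subseteq> T"
  shows "lext M g p = (\<Oplus>\<^bsub>M\<^esub>x\<in>T. Poly_Mapping.lookup p x \<odot>\<^bsub>M\<^esub> g x)"
  unfolding lext_def
  by (rule M.add.finprod_mono_neutral_cong_left)
     (use g T in \<open>auto simp: in_keys_iff Pi_def kspace_simps\<close>)

lemma lext_closed:
  assumes "g \<in> S \<rightarrow> carrier M" and "p \<in> free S"
  shows "lext M g p \<in> carrier M"
  unfolding lext_def
  using assms by (intro M.finsum_closed) (auto simp: free_def kspace_simps Pi_def subset_iff)

lemma lext_add:
  assumes g: "g \<in> S \<rightarrow> carrier M" and pq: "p \<in> free S" "q \<in> free S"
  shows "lext M g (p + q) = lext M g p \<oplus>\<^bsub>M\<^esub> lext M g q"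
proof -
  let ?T = "Poly_Mapping.keys p \<union> Poly_Mapping.keys q"
  have g': "g \<in> ?T \<rightarrow> carrier M" using g pq by (auto simp: free_def)
  have "lext M g p \<oplus>\<^bsub>M\<^esub> lext M g q =
      (\<Oplus>\<^bsub>M\<^esub>x\<in>?T. Poly_Mapping.lookup p x \<odot>\<^bsub>M\<^esub> g x \<oplus>\<^bsub>M\<^esub> Poly_Mapping.lookup q x \<odot>\<^bsub>M\<^esub> g x)"
    by (subst M.finsum_addf) (use g' in \<open>auto simp: lext_superset[OF g'] Pi_def kspace_simps\<close>)
  also have "\<dots> = lext M g (p + q)"
    unfolding lext_superset[OF g' finite_UnI[OF finite_keys finite_keys] Poly_Mapping.keys_add]
    by (rule M.finsum_cong') (use g' in \<open>auto simp: Pi_def kspace_simps lookup_add\<close>)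
  finally show ?thesis ..
qed

lemma lext_scale:
  assumes g: "g \<in> S \<rightarrow> carrier M" and p: "p \<in> free S"
  shows "lext M g (fscale c p) = c \<odot>\<^bsub>M\<^esub> lext M g p"
proof -
  let ?T = "Poly_Mapping.keys p"
  have g': "g \<in> ?T \<rightarrow> carrier M" using g p by (auto simp: free_def)
  have *: "Poly_Mapping.keys (fscale c p) \<subseteq> ?T" by (auto simp: in_keys_iff)
  have "c \<odot>\<^bsub>M\<^esub> lext M g p = (\<Oplus>\<^bsub>M\<^esub>x\<in>?T. c \<odot>\<^bsub>M\<^esub> (Poly_Mapping.lookup p x \<odot>\<^bsub>M\<^esub> g x))"
    unfolding lext_def
    using M.finsum_smult_ldistr[of ?T c "\<lambda>x. Poly_Mapping.lookup p x \<odot>\<^bsub>M\<^esub> g x"] g'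
    by (auto simp: Pi_def kspace_simps)
  also have "\<dots> = lext M g (fscale c p)"
    unfolding lext_superset[OF g' finite_keys *]
    by (rule M.finsum_cong') (use g' in \<open>auto simp: Pi_def kspace_simps\<close>)
  finally show ?thesis ..
qed

lemma lext_single:
  assumes "g x \<in> carrier M"
  shows "lext M g (Poly_Mapping.single x c) = c \<odot>\<^bsub>M\<^esub> g x"
  by (subst lext_superset[of _ "{x}"]) (use assms in \<open>auto simp: kspace_simps\<close>)

lemma lext_zero: "lext M g 0 = \<zero>\<^bsub>M\<^esub>"
  by (simp add: lext_def)

lemma lext_diff:
  assumes g: "g \<in> S \<rightarrow> carrier M" and pq: "p \<in> free S" "q \<in> free S"
  shows "lext M g (p - q) = lext M g p \<oplus>\<^bsub>M\<^esub> (-1) \<odot>\<^bsub>M\<^esub> lext M g q"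
proof -
  have "p - q = p + fscale (-1) q"
    by (rule poly_mapping_eqI) (simp add: lookup_minus lookup_add)
  then show ?thesis
    by (simp only: lext_add[OF g pq(1) free_scale[OF pq(2)]] lext_scale[OF g pq(2)])
qed

lemma diff_eq_zeroI: "x \<in> carrier M \<Longrightarrow> x \<oplus>\<^bsub>M\<^esub> (-1) \<odot>\<^bsub>M\<^esub> x = \<zero>\<^bsub>M\<^esub>"
  using kspace_simps(5)[of x 1 "-1"] by (simp add: kspace_simps)

lemma eq_if_diff_eq_zero:
  assumes "x \<in> carrier M" "y \<in> carrier M" and "x \<oplus>\<^bsub>M\<^esub> (-1) \<odot>\<^bsub>M\<^esub> y = \<zero>\<^bsub>M\<^esub>"
  shows "x = y"
  using assms diff_eq_zeroI[of y]
  by (metis M.add.inv_closed M.add.right_cancel kspace_simps(1))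

text \<open>The kernel of a linear map is a subspace, so relations need only be checked on the elements that
  span them.\<close>

lemma lext_span_zero:
  assumes g: "g \<in> S \<rightarrow> carrier M" and R: "R \<subseteq> free S"
    and zero: "\<And>r. r \<in> R \<Longrightarrow> lext M g r = \<zero>\<^bsub>M\<^esub>" and p: "p \<in> fspan R"
  shows "lext M g p = \<zero>\<^bsub>M\<^esub>"
proof -
  have "fv.subspace {p \<in> free S. lext M g p = \<zero>\<^bsub>M\<^esub>}"
    by (rule fv.subspaceI)
       (auto simp: free_zero free_add free_scale lext_zero lext_add[OF g] lext_scale[OF g] kspace_simps)
  then have "fv.span R \<subseteq> {p \<in> free S. lext M g p = \<zero>\<^bsub>M\<^esub>}"
    by (intro fv.span_minimal) (use R zero in auto)
  then show ?thesis using p by (auto simp: fspan_def)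
qed

lemma linmap_zero:
  assumes "kspace A" and f: "linmap A M f"
  shows "f \<zero>\<^bsub>A\<^esub> = \<zero>\<^bsub>M\<^esub>"
proof -
  interpret A: Module.module scalars A by fact
  have "f (0 \<odot>\<^bsub>A\<^esub> \<zero>\<^bsub>A\<^esub>) = 0 \<odot>\<^bsub>M\<^esub> f \<zero>\<^bsub>A\<^esub>"
    by (rule linmap_smult[OF f]) simp
  then show ?thesis
    using A.smult_l_null[of "\<zero>\<^bsub>A\<^esub>"] linmap_closed[OF f] by (simp add: kspace_simps)
qed

end

section \<open>Quotients of monoid algebras\<close>

lemma rep_coset: "rep (coset_of (fspan R) p) - p \<in> fspan R"
proof -
  have "p \<in> coset_of (fspan R) p"
    by (simp add: coset_of_def fspan_def fv.span_zero)
  then have "rep (coset_of (fspan R) p) \<in> coset_of (fspan R) p"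
    unfolding rep_def by (rule someI)
  then show ?thesis by (simp add: coset_of_def)
qed

lemma coset_eqI: 
  assumes "p - q \<in> fspan R" shows "coset_of (fspan R) p = coset_of (fspan R) q"
proof -
  have "r - p \<in> fspan R \<longleftrightarrow> r - q \<in> fspan R" for r
    using assms fv.span_add[of "r - p" R "p - q"] fv.span_diff[of "r - q" R "p - q"]
    by (auto simp: fspan_def)
  then show ?thesis by (simp add: coset_of_def)
qed

text \<open>As for \<^const>\<open>lext\<close>, bilinearity of \<^const>\<open>fmult\<close> is proved by enlarging the index sets, so that
  cancellation among the keys does not matter.\<close>

lemma fmult_superset:
  assumes "finite A" "finite B" "Poly_Mapping.keys p \<subseteq> A" "Poly_Mapping.keys q \<subseteq> B"
  shows "fmult m p q = (\<Sum>x\<in>A. \<Sum>y\<in>B.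
        Poly_Mapping.single (m x y) (Poly_Mapping.lookup p x * Poly_Mapping.lookup q y))"
  unfolding fmult_def
  by (intro sum.mono_neutral_cong_left) (use assms in \<open>auto simp: in_keys_iff\<close>)

lemma fmult_add_left: "fmult m (p + p') q = fmult m p q + fmult m p' q"
  using Poly_Mapping.keys_add[of p p']
  by (simp add: fmult_superset[of "Poly_Mapping.keys p \<union> Poly_Mapping.keys p'" "Poly_Mapping.keys q"]
      lookup_add algebra_simps single_add sum.distrib)

lemma fmult_add_right: "fmult m p (q + q') = fmult m p q + fmult m p q'"
  using Poly_Mapping.keys_add[of q q']
  by (simp add: fmult_superset[of "Poly_Mapping.keys p" "Poly_Mapping.keys q \<union> Poly_Mapping.keys q'"]
      lookup_add algebra_simps single_add sum.distrib)

lemma fmult_scale_left: "fmult m (fscale c p) q = fscale c (fmult m p q)"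
proof -
  have "Poly_Mapping.keys (fscale c p) \<subseteq> Poly_Mapping.keys p" by (auto simp: in_keys_iff)
  then show ?thesis
    by (simp add: fmult_superset[of "Poly_Mapping.keys p" "Poly_Mapping.keys q"] fv.scale_sum_right mult.assoc)
qed

lemma fmult_scale_right: "fmult m p (fscale c q) = fscale c (fmult m p q)"
proof -
  have "Poly_Mapping.keys (fscale c q) \<subseteq> Poly_Mapping.keys q" by (auto simp: in_keys_iff)
  then show ?thesis
    by (simp add: fmult_superset[of "Poly_Mapping.keys p" "Poly_Mapping.keys q"] fv.scale_sum_right mult.left_commute)
qed

lemma fmult_single [simp]:
  "fmult m (Poly_Mapping.single x a) (Poly_Mapping.single y b) = Poly_Mapping.single (m x y) (a * b)"
  by (subst fmult_superset[of "{x}" "{y}"]) auto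

lemma fmult_zero [simp]: "fmult m 0 q = 0" "fmult m p 0 = 0"
  by (simp_all add: fmult_def)

lemma fmult_diff_left: "fmult m (p - p') q = fmult m p q - fmult m p' q"
  using fmult_add_left[of m "p - p'" p' q] by (simp add: algebra_simps)

lemma fmult_diff_right: "fmult m p (q - q') = fmult m p q - fmult m p q'"
  using fmult_add_right[of m p "q - q'" q'] by (simp add: algebra_simps)

text \<open>Only the linear structure, the unit element and bilinearity of the product are recorded.  The
  computations below take place on words and pure tensors, where products are explicit.\<close>

locale kalg = Module.module scalars A for A :: "('k::field, 'a) module" +
  assumes kalg_one [simp]: "\<one>\<^bsub>A\<^esub> \<in> carrier A"
    and kalg_mult [simp]: "a \<in> carrier A \<Longrightarrow> b \<in> carrier A \<Longrightarrow> a \<otimes>\<^bsub>A\<^esub> b \<in> carrier A"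
    and kalg_l_distr: "a \<in> carrier A \<Longrightarrow> a' \<in> carrier A \<Longrightarrow> b \<in> carrier A \<Longrightarrow>
      (a \<oplus>\<^bsub>A\<^esub> a') \<otimes>\<^bsub>A\<^esub> b = a \<otimes>\<^bsub>A\<^esub> b \<oplus>\<^bsub>A\<^esub> a' \<otimes>\<^bsub>A\<^esub> b"
    and kalg_r_distr: "a \<in> carrier A \<Longrightarrow> b \<in> carrier A \<Longrightarrow> b' \<in> carrier A \<Longrightarrow>
      a \<otimes>\<^bsub>A\<^esub> (b \<oplus>\<^bsub>A\<^esub> b') = a \<otimes>\<^bsub>A\<^esub> b \<oplus>\<^bsub>A\<^esub> a \<otimes>\<^bsub>A\<^esub> b'"
    and kalg_smult_l: "a \<in> carrier A \<Longrightarrow> b \<in> carrier A \<Longrightarrow>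
      (c \<odot>\<^bsub>A\<^esub> a) \<otimes>\<^bsub>A\<^esub> b = c \<odot>\<^bsub>A\<^esub> (a \<otimes>\<^bsub>A\<^esub> b)"
    and kalg_smult_r: "a \<in> carrier A \<Longrightarrow> b \<in> carrier A \<Longrightarrow>
      a \<otimes>\<^bsub>A\<^esub> (c \<odot>\<^bsub>A\<^esub> b) = c \<odot>\<^bsub>A\<^esub> (a \<otimes>\<^bsub>A\<^esub> b)"

text \<open>The ideal condition is stated for products of a basis element with a spanning relation.  This is
  what can be checked by inspection of the relations, and bilinearity extends it to the whole span
  (\<open>fmult_ideal\<close>).\<close>

locale free_quotient =
  fixes S :: "'x set" and m :: "'x \<Rightarrow> 'x \<Rightarrow> 'x" and e :: 'x and R :: "('x \<Rightarrow>\<^sub>0 'k::field) set"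
  assumes R_free: "R \<subseteq> free S"
    and m_closed: "x \<in> S \<Longrightarrow> y \<in> S \<Longrightarrow> m x y \<in> S"
    and e_closed: "e \<in> S"
    and R_left: "x \<in> S \<Longrightarrow> r \<in> R \<Longrightarrow> fmult m (Poly_Mapping.single x 1) r \<in> fspan R"
    and R_right: "x \<in> S \<Longrightarrow> r \<in> R \<Longrightarrow> fmult m r (Poly_Mapping.single x 1) \<in> fspan R"
begin

abbreviation "Q \<equiv> quot_algebra S m e (fspan R)"
abbreviation "cl \<equiv> coset_of (fspan R)"

lemma span_free: "fspan R \<subseteq> free S"
  unfolding fspan_def by (rule fv.span_minimal[OF R_free free_subspace])

lemma carrierE:
  assumes "X \<in> carrier Q" obtains p where "p \<in> free S" "X = cl p"
  using assms by (auto simp: quot_algebra_def free_def)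

lemma cl_closed: "p \<in> free S \<Longrightarrow> cl p \<in> carrier Q"
  by (auto simp: quot_algebra_def free_def)

lemma rep_free: 
  assumes "X \<in> carrier Q" shows "rep X \<in> free S"
proof -
  from assms obtain p where p: "p \<in> free S" "X = cl p" by (rule carrierE)
  then have "rep X - p \<in> free S" using rep_coset span_free by blast
  from free_add[OF this p(1)] show ?thesis by simp
qed

lemma fmult_free: 
  assumes "p \<in> free S" "q \<in> free S" shows "fmult m p q \<in> free S"
  unfolding fmult_def
  by (intro free_sum free_single m_closed) (use assms in \<open>auto simp: free_def\<close>)

lemma fmult_single_ideal:
  assumes "x \<in> S" "r \<in> fspan R"
  shows "fmult m (Poly_Mapping.single x c) r \<in> fspan R"
    and "fmult m r (Poly_Mapping.single x c) \<in> fspan R"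
proof -
  have x: "Poly_Mapping.single x c = fscale c (Poly_Mapping.single x 1)" by simp
  have "r \<in> fv.span R" using assms by (simp add: fspan_def)
  then have "fmult m (Poly_Mapping.single x 1) r \<in> fv.span R \<and> fmult m r (Poly_Mapping.single x 1) \<in> fv.span R"
  proof (induction rule: fv.span_induct_alt)
    case base
    show ?case by (simp add: fv.span_zero)
  next
    case (step c r q)
    then show ?case
      using R_left[OF assms(1)] R_right[OF assms(1)]
      by (simp add: fmult_add_left fmult_add_right fmult_scale_left fmult_scale_right
          fspan_def fv.span_add fv.span_scale)
  qed
  then show "fmult m (Poly_Mapping.single x c) r \<in> fspan R" "fmult m r (Poly_Mapping.single x c) \<in> fspan R"
    unfolding x fmult_scale_left fmult_scale_right by (auto simp: fspan_def fv.span_scale)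
qed

lemma fmult_ideal:
  assumes "p \<in> free S" "r \<in> fspan R"
  shows "fmult m p r \<in> fspan R \<and> fmult m r p \<in> fspan R"
  using assms
  by (induction rule: free_induct)
     (auto simp: fmult_single_ideal fmult_add_left fmult_add_right
        fv.span_zero[folded fspan_def] fv.span_add[folded fspan_def])

lemma cl_add: "cl p \<oplus>\<^bsub>Q\<^esub> cl q = cl (p + q)"
  using fv.span_add[OF rep_coset[of R p, unfolded fspan_def] rep_coset[of R q, unfolded fspan_def]]
  by (auto simp: quot_algebra_def fspan_def algebra_simps intro!: coset_eqI[unfolded fspan_def])

lemma cl_smult: "c \<odot>\<^bsub>Q\<^esub> cl p = cl (fscale c p)"
  using fv.span_scale[OF rep_coset[of R p, unfolded fspan_def], of c]
  by (auto simp: quot_algebra_def fspan_def fv.scale_right_diff_distrib intro!: coset_eqI[unfolded fspan_def])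

lemma cl_zero: "\<zero>\<^bsub>Q\<^esub> = cl 0"
  by (simp add: quot_algebra_def)

lemma cl_one: "\<one>\<^bsub>Q\<^esub> = cl (Poly_Mapping.single e 1)"
  by (simp add: quot_algebra_def)

text \<open>Replacing \<open>p\<close> and \<open>q\<close> by the chosen representatives \<open>p'\<close> and \<open>q'\<close> changes the product by
  \<open>p'(q' - q) + (p' - p)q\<close>, which lies in the ideal.\<close>

lemma cl_mult:
  assumes "p \<in> free S" "q \<in> free S"
  shows "cl p \<otimes>\<^bsub>Q\<^esub> cl q = cl (fmult m p q)"
proof -
  let ?p = "rep (cl p)" and ?q = "rep (cl q)"
  have "fmult m ?p (?q - q) + fmult m (?p - p) q \<in> fspan R"
    using fmult_ideal[OF rep_free[OF cl_closed[OF assms(1)]] rep_coset, of q] fmult_ideal[OF assms(2) rep_coset, of p]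
    unfolding fspan_def by (intro fv.span_add) auto
  then show ?thesis
    by (auto simp: quot_algebra_def fmult_diff_left fmult_diff_right intro!: coset_eqI)
qed

lemma kspace_Q: "kspace Q"
proof (rule kspaceI)
  fix c X assume "X \<in> carrier Q"
  then obtain p where p: "p \<in> free S" "X = cl p" by (rule carrierE)
  show "(-1) \<odot>\<^bsub>Q\<^esub> X \<oplus>\<^bsub>Q\<^esub> X = \<zero>\<^bsub>Q\<^esub>"
    unfolding p(2) cl_smult cl_add cl_zero by simp
qed (auto elim!: carrierE simp: cl_add cl_smult cl_zero fv.scale_left_distrib fv.scale_right_distrib
      intro!: cl_closed free_add free_scale free_zero simp: algebra_simps)

lemma kalg_Q: "kalg Q"
proof (rule kalg.intro[OF kspace_Q], unfold_locales)
  show "\<one>\<^bsub>Q\<^esub> \<in> carrier Q" by (simp add: cl_one cl_closed free_single e_closed)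
qed (auto elim!: carrierE simp: cl_add cl_smult cl_mult free_add free_scale fmult_free cl_closed
      fmult_add_left fmult_add_right fmult_scale_left fmult_scale_right)

text \<open>The cosets of the basis elements span the quotient.\<close>

lemma Q_induct [consumes 1, case_names base add smult]:
  assumes X: "X \<in> carrier Q"
    and base: "\<And>x. x \<in> S \<Longrightarrow> P (cl (Poly_Mapping.single x 1))"
    and add: "\<And>X Y. X \<in> carrier Q \<Longrightarrow> Y \<in> carrier Q \<Longrightarrow> P X \<Longrightarrow> P Y \<Longrightarrow> P (X \<oplus>\<^bsub>Q\<^esub> Y)"
    and smult: "\<And>c X. X \<in> carrier Q \<Longrightarrow> P X \<Longrightarrow> P (c \<odot>\<^bsub>Q\<^esub> X)"
  shows "P X"
proof -
  have s: "P (cl (Poly_Mapping.single x c))" if "x \<in> S" for x c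
    using smult[OF cl_closed base[OF that], OF free_single[OF that], of c] by (simp add: cl_smult)
  from X obtain p where p: "p \<in> free S" "X = cl p" by (rule carrierE)
  have "P (cl p)" using p(1)
  proof (induction rule: free_induct)
    case zero
    then show ?case using s[OF e_closed, of 0] by simp
  next
    case (add p q)
    then show ?case using assms(3)[of "cl p" "cl q"] by (simp add: cl_add cl_closed)
  qed (rule s)
  then show ?thesis using p by simp
qed

lemma induced_cl:
  assumes M: "kspace M" and g: "g \<in> S \<rightarrow> carrier M"
    and rel: "\<And>r. r \<in> R \<Longrightarrow> lext M g r = \<zero>\<^bsub>M\<^esub>"
    and p: "p \<in> free S"
  shows "induced M g (cl p) = lext M g p"
proof -
  let ?p = "rep (cl p)"
  have r: "?p \<in> free S" by (rule rep_free[OF cl_closed[OF p]])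
  have "lext M g (?p - p) = \<zero>\<^bsub>M\<^esub>"
    by (rule lext_span_zero[OF M g R_free rel rep_coset])
  then have "lext M g ?p = lext M g p"
    unfolding lext_diff[OF M g r p]
    by (intro eq_if_diff_eq_zero[OF M lext_closed[OF M g r] lext_closed[OF M g p]])
  then show ?thesis by (simp add: induced_def lext_def)
qed

text \<open>The universal property of the quotient: values on the basis that respect the relations extend
  to a linear map.\<close>

lemma induced_linmap:
  assumes M: "kspace M" and g: "g \<in> S \<rightarrow> carrier M"
    and rel: "\<And>r. r \<in> R \<Longrightarrow> lext M g r = \<zero>\<^bsub>M\<^esub>"
  shows "linmap Q M (induced M g)"
    and "\<And>x. x \<in> S \<Longrightarrow> induced M g (cl (Poly_Mapping.single x 1)) = g x"
proof -
  show "linmap Q M (induced M g)"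
    by (rule linmapI)
       (auto elim!: carrierE simp: cl_add cl_smult induced_cl[OF assms] free_add free_scale
          lext_closed[OF M g] lext_add[OF M g] lext_scale[OF M g])
  show "induced M g (cl (Poly_Mapping.single x 1)) = g x" if "x \<in> S" for x
    using that g by (simp add: induced_cl[OF assms] free_single lext_single[OF M] Pi_def kspace_simps[OF M])
qed

lemma induced_cong:
  assumes M: "kspace M" and g: "g \<in> S \<rightarrow> carrier M" and eq: "\<And>x. x \<in> S \<Longrightarrow> g x = h x"
    and X: "X \<in> carrier Q"
  shows "induced M g X = induced M h X"
proof -
  interpret M: Module.module scalars M by (rule M)
  show ?thesis
    unfolding induced_def
    by (rule M.finsum_cong') (use rep_free[OF X] g eq in \<open>auto simp: free_def Pi_def kspace_simps[OF M] subset_iff\<close>)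
qed

text \<open>The induced map depends linearly on the basis values as well.  This yields linearity in the second
  argument of forms that are obtained by inducing twice, and of Sweedler sums in the parameters
  of their summand.\<close>

lemma induced_param_linmap:
  assumes Z: "kspace Z" and M: "kspace M" and lin: "\<And>x. x \<in> S \<Longrightarrow> linmap Z M (\<lambda>z. F z x)" and X: "X \<in> carrier Q"
  shows "linmap Z M (\<lambda>z. induced M (F z) X)"
proof -
  interpret M: Module.module scalars M by (rule M)
  interpret Z: Module.module scalars Z by (rule Z)
  have S: "Poly_Mapping.keys (rep X) \<subseteq> S" using rep_free[OF X] by (simp add: free_def)
  have cl: "F z x \<in> carrier M" if "z \<in> carrier Z" "x \<in> Poly_Mapping.keys (rep X)" for z x
    using linmap_closed[OF lin] that S by blast
  show ?thesis
  proof (rule linmapI)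
    fix z assume z: "z \<in> carrier Z"
    show "induced M (F z) X \<in> carrier M"
      unfolding induced_def by (intro M.finsum_closed) (use z in \<open>auto simp: kspace_simps[OF M] cl\<close>)
    fix z' assume z': "z' \<in> carrier Z"
    have "induced M (F z) X \<oplus>\<^bsub>M\<^esub> induced M (F z') X = (\<Oplus>\<^bsub>M\<^esub>x\<in>Poly_Mapping.keys (rep X).
        Poly_Mapping.lookup (rep X) x \<odot>\<^bsub>M\<^esub> F z x \<oplus>\<^bsub>M\<^esub> Poly_Mapping.lookup (rep X) x \<odot>\<^bsub>M\<^esub> F z' x)"
      unfolding induced_def
      by (rule M.finsum_addf[symmetric]) (use z z' in \<open>auto simp: kspace_simps[OF M] cl\<close>)
    also have "\<dots> = induced M (F (z \<oplus>\<^bsub>Z\<^esub> z')) X"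
      unfolding induced_def
      by (rule M.finsum_cong')
         (use S z z' in \<open>auto simp: linmap_add[OF lin] kspace_simps[OF M] cl subset_iff\<close>)
    finally show "induced M (F (z \<oplus>\<^bsub>Z\<^esub> z')) X = induced M (F z) X \<oplus>\<^bsub>M\<^esub> induced M (F z') X" ..
  next
    fix c z assume z: "z \<in> carrier Z"
    have comm: "c \<odot>\<^bsub>M\<^esub> (d \<odot>\<^bsub>M\<^esub> y) = d \<odot>\<^bsub>M\<^esub> (c \<odot>\<^bsub>M\<^esub> y)" if "y \<in> carrier M" for d y
      using that by (simp add: mult.commute flip: kspace_simps(7)[OF M])
    have "c \<odot>\<^bsub>M\<^esub> induced M (F z) X = (\<Oplus>\<^bsub>M\<^esub>x\<in>Poly_Mapping.keys (rep X). c \<odot>\<^bsub>M\<^esub> (Poly_Mapping.lookup (rep X) x \<odot>\<^bsub>M\<^esub> F z x))"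
      unfolding induced_def
      by (rule M.finsum_smult_ldistr) (use z in \<open>auto simp: kspace_simps[OF M] cl\<close>)
    also have "\<dots> = induced M (F (c \<odot>\<^bsub>Z\<^esub> z)) X"
      unfolding induced_def
      by (rule M.finsum_cong')
         (use S z in \<open>auto simp: linmap_smult[OF lin] kspace_simps[OF M] cl comm subset_iff\<close>)
    finally show "induced M (F (c \<odot>\<^bsub>Z\<^esub> z)) X = c \<odot>\<^bsub>M\<^esub> induced M (F z) X" ..
  qed
qed

end

definition bilinmap ::
  "('k::field, 'a) module \<Rightarrow> ('k, 'b) module \<Rightarrow> ('k, 'm) module \<Rightarrow> ('a \<Rightarrow> 'b \<Rightarrow> 'm) \<Rightarrow> bool" where
  "bilinmap A B M f \<longleftrightarrow>
     (\<forall>a\<in>carrier A. linmap B M (f a)) \<and> (\<forall>b\<in>carrier B. linmap A M (\<lambda>a. f a b))"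

lemma bilinmapI:
  assumes "\<And>a. a \<in> carrier A \<Longrightarrow> linmap B M (f a)"
    and "\<And>b. b \<in> carrier B \<Longrightarrow> linmap A M (\<lambda>a. f a b)"
  shows "bilinmap A B M f"
  using assms by (simp add: bilinmap_def)

lemma
  assumes "bilinmap A B M f"
  shows bilinmap_right: "a \<in> carrier A \<Longrightarrow> linmap B M (f a)"
    and bilinmap_left: "b \<in> carrier B \<Longrightarrow> linmap A M (\<lambda>a. f a b)"
    and bilinmap_closed: "a \<in> carrier A \<Longrightarrow> b \<in> carrier B \<Longrightarrow> f a b \<in> carrier M"
  using assms by (auto simp: bilinmap_def linmap_def)

lemma linmap_compose:
  assumes "linmap A B f" and "linmap B C g"
  shows "linmap A C (\<lambda>x. g (f x))"
  using assms by (auto simp: linmap_def Pi_def)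

lemma lext_additivity:
  assumes M: "kspace M" and "g y \<in> carrier M" "g z \<in> carrier M" and eq: "g x = g y \<oplus>\<^bsub>M\<^esub> g z"
  shows "lext M g (Poly_Mapping.single x 1 - Poly_Mapping.single y 1 - Poly_Mapping.single z 1) = \<zero>\<^bsub>M\<^esub>"
proof -
  interpret M: Module.module scalars M by (rule M)
  have g: "g \<in> {x, y, z} \<rightarrow> carrier M" using assms by auto
  have *: "a \<oplus>\<^bsub>M\<^esub> b \<oplus>\<^bsub>M\<^esub> (-1) \<odot>\<^bsub>M\<^esub> a \<oplus>\<^bsub>M\<^esub> (-1) \<odot>\<^bsub>M\<^esub> b = \<zero>\<^bsub>M\<^esub>"
    if "a \<in> carrier M" "b \<in> carrier M" for a b
  proof -
    have "a \<oplus>\<^bsub>M\<^esub> b \<oplus>\<^bsub>M\<^esub> (-1) \<odot>\<^bsub>M\<^esub> a \<oplus>\<^bsub>M\<^esub> (-1) \<odot>\<^bsub>M\<^esub> b = (a \<oplus>\<^bsub>M\<^esub> (-1) \<odot>\<^bsub>M\<^esub> a) \<oplus>\<^bsub>M\<^esub> (b \<oplus>\<^bsub>M\<^esub> (-1) \<odot>\<^bsub>M\<^esub> b)"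
      using that by (simp add: M.add.m_ac kspace_simps[OF M])
    then show ?thesis using that by (simp add: diff_eq_zeroI[OF M])
  qed
  show ?thesis
    using assms *[of "g y" "g z"]
    by (simp add: lext_diff[OF M g] free_single free_diff lext_single[OF M] kspace_simps[OF M])
qed

lemma lext_homogeneity:
  assumes M: "kspace M" and "g y \<in> carrier M" and eq: "g x = c \<odot>\<^bsub>M\<^esub> g y"
  shows "lext M g (Poly_Mapping.single x 1 - Poly_Mapping.single y c) = \<zero>\<^bsub>M\<^esub>"
proof -
  have g: "g \<in> {x, y} \<rightarrow> carrier M" using assms by (auto simp: kspace_simps[OF M])
  show ?thesis
    using assms
    by (simp add: lext_diff[OF M g] free_single lext_single[OF M] kspace_simps[OF M] diff_eq_zeroI[OF M])
qed

context free_quotient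
begin

lemma cl_additivity:
  assumes "Poly_Mapping.single x 1 - Poly_Mapping.single y 1 - Poly_Mapping.single z 1 \<in> R"
  shows "cl (Poly_Mapping.single x 1) = cl (Poly_Mapping.single y 1) \<oplus>\<^bsub>Q\<^esub> cl (Poly_Mapping.single z 1)"
  unfolding cl_add
  by (rule coset_eqI) (use fv.span_base[OF assms] in \<open>simp add: fspan_def algebra_simps\<close>)

lemma cl_homogeneity:
  assumes "Poly_Mapping.single x 1 - Poly_Mapping.single y c \<in> R"
  shows "cl (Poly_Mapping.single x 1) = c \<odot>\<^bsub>Q\<^esub> cl (Poly_Mapping.single y 1)"
  unfolding cl_smult
  by (rule coset_eqI) (use fv.span_base[OF assms] in \<open>simp add: fspan_def\<close>)

end

section \<open>Tensor products of algebras\<close>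

text \<open>The locale \<open>free_quotient\<close> speaks of a spanning set of relations, whereas \<^const>\<open>tensor_rels\<close>
  denotes its span.\<close>

definition tensor_gens ::
  "('k::field, 'a) module \<Rightarrow> ('k, 'b) module \<Rightarrow> ('a \<times> 'b \<Rightarrow>\<^sub>0 'k) set" where
  "tensor_gens A B =
     {Poly_Mapping.single (a \<oplus>\<^bsub>A\<^esub> a', b) 1 - Poly_Mapping.single (a, b) 1 - Poly_Mapping.single (a', b) 1
        | a a' b. a \<in> carrier A \<and> a' \<in> carrier A \<and> b \<in> carrier B} \<union>
     {Poly_Mapping.single (a, b \<oplus>\<^bsub>B\<^esub> b') 1 - Poly_Mapping.single (a, b) 1 - Poly_Mapping.single (a, b') 1
        | a b b'. a \<in> carrier A \<and> b \<in> carrier B \<and> b' \<in> carrier B} \<union>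
     {Poly_Mapping.single (c \<odot>\<^bsub>A\<^esub> a, b) 1 - Poly_Mapping.single (a, b) c
        | c a b. a \<in> carrier A \<and> b \<in> carrier B} \<union>
     {Poly_Mapping.single (a, c \<odot>\<^bsub>B\<^esub> b) 1 - Poly_Mapping.single (a, b) c
        | c a b. a \<in> carrier A \<and> b \<in> carrier B}"

lemma tensor_gens_cases [consumes 1, case_names add_left add_right smult_left smult_right]:
  assumes "r \<in> tensor_gens A B"
  obtains
    a a' b where "a \<in> carrier A" "a' \<in> carrier A" "b \<in> carrier B"
      "r = Poly_Mapping.single (a \<oplus>\<^bsub>A\<^esub> a', b) 1 - Poly_Mapping.single (a, b) 1 - Poly_Mapping.single (a', b) 1"
  | a b b' where "a \<in> carrier A" "b \<in> carrier B" "b' \<in> carrier B"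
      "r = Poly_Mapping.single (a, b \<oplus>\<^bsub>B\<^esub> b') 1 - Poly_Mapping.single (a, b) 1 - Poly_Mapping.single (a, b') 1"
  | c a b where "a \<in> carrier A" "b \<in> carrier B"
      "r = Poly_Mapping.single (c \<odot>\<^bsub>A\<^esub> a, b) 1 - Poly_Mapping.single (a, b) c"
  | c a b where "a \<in> carrier A" "b \<in> carrier B"
      "r = Poly_Mapping.single (a, c \<odot>\<^bsub>B\<^esub> b) 1 - Poly_Mapping.single (a, b) c"
  using assms unfolding tensor_gens_def by blast

lemma tensor_gens_intros:
  "a \<in> carrier A \<Longrightarrow> a' \<in> carrier A \<Longrightarrow> b \<in> carrier B \<Longrightarrow>
    Poly_Mapping.single (a \<oplus>\<^bsub>A\<^esub> a', b) 1 - Poly_Mapping.single (a, b) 1 - Poly_Mapping.single (a', b) 1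
      \<in> tensor_gens A B"
  "a \<in> carrier A \<Longrightarrow> b \<in> carrier B \<Longrightarrow> b' \<in> carrier B \<Longrightarrow>
    Poly_Mapping.single (a, b \<oplus>\<^bsub>B\<^esub> b') 1 - Poly_Mapping.single (a, b) 1 - Poly_Mapping.single (a, b') 1
      \<in> tensor_gens A B"
  "a \<in> carrier A \<Longrightarrow> b \<in> carrier B \<Longrightarrow>
    Poly_Mapping.single (c \<odot>\<^bsub>A\<^esub> a, b) 1 - Poly_Mapping.single (a, b) c \<in> tensor_gens A B"
  "a \<in> carrier A \<Longrightarrow> b \<in> carrier B \<Longrightarrow>
    Poly_Mapping.single (a, c \<odot>\<^bsub>B\<^esub> b) 1 - Poly_Mapping.single (a, b) c \<in> tensor_gens A B"
  unfolding tensor_gens_def by blast+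

lemma tensor_rels_eq: "tensor_rels A B = fspan (tensor_gens A B)"
  by (simp add: tensor_rels_def tensor_gens_def)

context
  fixes A :: "('k::field, 'a) module" and B :: "('k, 'b) module"
  assumes A: "kalg A" and B: "kalg B"
begin

interpretation A: kalg A by (rule A)
interpretation B: kalg B by (rule B)

interpretation T: free_quotient "carrier A \<times> carrier B"
  "\<lambda>(a, b) (a', b'). (a \<otimes>\<^bsub>A\<^esub> a', b \<otimes>\<^bsub>B\<^esub> b')" "(\<one>\<^bsub>A\<^esub>, \<one>\<^bsub>B\<^esub>)" "tensor_gens A B"
proof
  show "tensor_gens A B \<subseteq> free (carrier A \<times> carrier B)"
  proof
    fix r assume "r \<in> tensor_gens A B"
    then show "r \<in> free (carrier A \<times> carrier B)"
      by (cases rule: tensor_gens_cases)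
         (auto intro!: free_diff free_single simp: kspace_simps[OF A.module_axioms] kspace_simps[OF B.module_axioms])
  qed
next
  fix x r assume x: "x \<in> carrier A \<times> carrier B" and r: "r \<in> tensor_gens A B"
  have base: "r \<in> tensor_gens A B \<Longrightarrow> r \<in> fspan (tensor_gens A B)" for r
    by (simp add: fspan_def fv.span_base)
  obtain a0 b0 where [simp]: "x = (a0, b0)" "a0 \<in> carrier A" "b0 \<in> carrier B" using x by auto
  from r show "fmult (\<lambda>(a, b) (a', b'). (a \<otimes>\<^bsub>A\<^esub> a', b \<otimes>\<^bsub>B\<^esub> b')) (Poly_Mapping.single x 1) r
      \<in> fspan (tensor_gens A B)"
    by (cases rule: tensor_gens_cases)
       (auto simp: fmult_diff_right A.kalg_r_distr B.kalg_r_distr A.kalg_smult_r B.kalg_smult_r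
         intro!: base tensor_gens_intros)
  from r show "fmult (\<lambda>(a, b) (a', b'). (a \<otimes>\<^bsub>A\<^esub> a', b \<otimes>\<^bsub>B\<^esub> b')) r (Poly_Mapping.single x 1)
      \<in> fspan (tensor_gens A B)"
    by (cases rule: tensor_gens_cases)
       (auto simp: fmult_diff_left A.kalg_l_distr B.kalg_l_distr A.kalg_smult_l B.kalg_smult_l
         intro!: base tensor_gens_intros)
qed auto

lemma tensor_alg_eq: "tensor_alg A B = T.Q"
  by (simp add: tensor_alg_def tensor_rels_eq)

lemma tensor_eq: "tensor A B a b = T.cl (Poly_Mapping.single (a, b) 1)"
  by (simp add: tensor_def tensor_rels_eq)

lemma kalg_tensor_alg: "kalg (tensor_alg A B)"
  unfolding tensor_alg_eq by (rule T.kalg_Q)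

lemma tensor_closed:
  "a \<in> carrier A \<Longrightarrow> b \<in> carrier B \<Longrightarrow> tensor A B a b \<in> carrier (tensor_alg A B)"
  unfolding tensor_alg_eq tensor_eq by (rule T.cl_closed[OF free_single]) simp

lemma tensor_one: "\<one>\<^bsub>tensor_alg A B\<^esub> = tensor A B \<one>\<^bsub>A\<^esub> \<one>\<^bsub>B\<^esub>"
  unfolding tensor_alg_eq tensor_eq by (rule T.cl_one)

lemma tensor_mult:
  assumes "a \<in> carrier A" "b \<in> carrier B" "a' \<in> carrier A" "b' \<in> carrier B"
  shows "tensor A B a b \<otimes>\<^bsub>tensor_alg A B\<^esub> tensor A B a' b' = tensor A B (a \<otimes>\<^bsub>A\<^esub> a') (b \<otimes>\<^bsub>B\<^esub> b')"
  unfolding tensor_alg_eq tensor_eq using assms by (simp add: T.cl_mult free_single)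

lemma tensor_bilinmap: "bilinmap A B (tensor_alg A B) (tensor A B)"
  by (intro bilinmapI linmapI)
     (auto simp: tensor_closed tensor_alg_eq tensor_eq
       intro!: T.cl_additivity T.cl_homogeneity tensor_gens_intros T.cl_closed free_single)

lemma tensor_induct [consumes 1, case_names tensor add smult]:
  assumes "X \<in> carrier (tensor_alg A B)"
    and "\<And>a b. a \<in> carrier A \<Longrightarrow> b \<in> carrier B \<Longrightarrow> P (tensor A B a b)"
    and "\<And>X Y. X \<in> carrier (tensor_alg A B) \<Longrightarrow> Y \<in> carrier (tensor_alg A B) \<Longrightarrow>
      P X \<Longrightarrow> P Y \<Longrightarrow> P (X \<oplus>\<^bsub>tensor_alg A B\<^esub> Y)"
    and "\<And>c X. X \<in> carrier (tensor_alg A B) \<Longrightarrow> P X \<Longrightarrow> P (c \<odot>\<^bsub>tensor_alg A B\<^esub> X)"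
  shows "P X"
  using assms(1)[unfolded tensor_alg_eq]
proof (induction rule: T.Q_induct)
  case (base x)
  then show ?case using assms(2)[of "fst x" "snd x"] by (auto simp: tensor_eq)
qed (use assms(3,4) in \<open>auto simp: tensor_alg_eq\<close>)

context
  fixes M :: "('k, 'm) module" and f :: "'a \<Rightarrow> 'b \<Rightarrow> 'm"
  assumes M: "kspace M" and f: "bilinmap A B M f"
begin

text \<open>The four families of relations are the four laws of a bilinear map.\<close>

lemma bilinmap_respects:
  assumes "r \<in> tensor_gens A B"
  shows "lext M (\<lambda>(a, b). f a b) r = \<zero>\<^bsub>M\<^esub>"
  using assms
  by (cases rule: tensor_gens_cases)
     (auto intro!: lext_additivity[OF M] lext_homogeneity[OF M] simp: bilinmap_closed[OF f]
        linmap_add[OF bilinmap_left[OF f]] linmap_add[OF bilinmap_right[OF f]]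
        linmap_smult[OF bilinmap_left[OF f]] linmap_smult[OF bilinmap_right[OF f]])

lemma sweedler_linmap: "linmap (tensor_alg A B) M (sweedler M f)"
  unfolding sweedler_def tensor_alg_eq
  by (rule T.induced_linmap[OF M _ bilinmap_respects]) (auto simp: bilinmap_closed[OF f])

lemma sweedler_tensor:
  assumes "a \<in> carrier A" "b \<in> carrier B"
  shows "sweedler M f (tensor A B a b) = f a b"
proof -
  have "(\<lambda>(a, b). f a b) \<in> carrier A \<times> carrier B \<rightarrow> carrier M"
    by (auto simp: bilinmap_closed[OF f])
  from T.induced_linmap(2)[OF M this bilinmap_respects, of "(a, b)"] assms show ?thesis
    by (simp add: sweedler_def tensor_eq)
qed

lemma sweedler_cong:
  assumes "\<And>a b. a \<in> carrier A \<Longrightarrow> b \<in> carrier B \<Longrightarrow> f a b = g a b"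
    and "X \<in> carrier (tensor_alg A B)"
  shows "sweedler M f X = sweedler M g X"
  unfolding sweedler_def
proof (rule T.induced_cong[OF M])
  show "(\<lambda>(a, b). f a b) \<in> carrier A \<times> carrier B \<rightarrow> carrier M"
    by (auto simp: bilinmap_closed[OF f])
qed (use assms in \<open>auto simp: tensor_alg_eq\<close>)

end

lemma sweedler_param_linmap:
  assumes "kspace Z" "kspace M"
    and "\<And>a b. a \<in> carrier A \<Longrightarrow> b \<in> carrier B \<Longrightarrow> linmap Z M (\<lambda>z. F z a b)"
    and "X \<in> carrier (tensor_alg A B)"
  shows "linmap Z M (\<lambda>z. sweedler M (F z) X)"
  unfolding sweedler_def
  by (rule T.induced_param_linmap) (use assms in \<open>auto simp: tensor_alg_eq\<close>)

end

section \<open>The tensor algebra\<close>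

definition word_gens :: "('k::field \<Rightarrow> 'u::ab_group_add \<Rightarrow> 'u) \<Rightarrow> ('u list \<Rightarrow>\<^sub>0 'k) set" where
  "word_gens s =
     {Poly_Mapping.single (w @ [x + y] @ w') 1 - Poly_Mapping.single (w @ [x] @ w') 1
        - Poly_Mapping.single (w @ [y] @ w') 1 | w x y w'. True} \<union>
     {Poly_Mapping.single (w @ [s c x] @ w') 1 - Poly_Mapping.single (w @ [x] @ w') c
        | w c x w'. True}"

lemma word_rels_eq: "word_rels s = fspan (word_gens s)"
  by (simp add: word_rels_def word_gens_def)

definition word :: "('k::field \<Rightarrow> 'u::ab_group_add \<Rightarrow> 'u) \<Rightarrow> 'u list \<Rightarrow> ('u list \<Rightarrow>\<^sub>0 'k) set" where
  "word s w = coset_of (word_rels s) (Poly_Mapping.single w 1)"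

text \<open>These are exactly the conditions under which \<open>g\<close> respects the relations of the tensor algebra.\<close>

definition multilinear ::
  "('k::field \<Rightarrow> 'u::ab_group_add \<Rightarrow> 'u) \<Rightarrow> ('k, 'm) module \<Rightarrow> ('u list \<Rightarrow> 'm) \<Rightarrow> bool" where
  "multilinear s M g \<longleftrightarrow> (\<forall>w. g w \<in> carrier M) \<and>
     (\<forall>w x y w'. g (w @ [x + y] @ w') = g (w @ [x] @ w') \<oplus>\<^bsub>M\<^esub> g (w @ [y] @ w')) \<and>
     (\<forall>w c x w'. g (w @ [s c x] @ w') = c \<odot>\<^bsub>M\<^esub> g (w @ [x] @ w'))"

context
  fixes s :: "'k::field \<Rightarrow> 'u::ab_group_add \<Rightarrow> 'u"
begin

lemma word_gens_cases:
  assumes "r \<in> word_gens s"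
  obtains
    w x y w' where "r = Poly_Mapping.single (w @ [x + y] @ w') 1 - Poly_Mapping.single (w @ [x] @ w') 1
        - Poly_Mapping.single (w @ [y] @ w') 1"
  | w c x w' where "r = Poly_Mapping.single (w @ [s c x] @ w') 1 - Poly_Mapping.single (w @ [x] @ w') c"
  using assms unfolding word_gens_def by blast

lemma word_gens_intros:
  "Poly_Mapping.single (w @ [x + y] @ w') 1 - Poly_Mapping.single (w @ [x] @ w') 1
        - Poly_Mapping.single (w @ [y] @ w') 1 \<in> word_gens s"
  "Poly_Mapping.single (w @ [s c x] @ w') 1 - Poly_Mapping.single (w @ [x] @ w') c \<in> word_gens s"
  unfolding word_gens_def by blast+

interpretation W: free_quotient UNIV "(@)" "[]" "word_gens s"
proof
  fix v :: "'u list" and r assume r: "r \<in> word_gens s"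
  from r show "fmult (@) (Poly_Mapping.single v 1) r \<in> fspan (word_gens s)"
    using word_gens_intros(1)[of "v @ w" for w] word_gens_intros(2)[of "v @ w" for w]
    by (cases rule: word_gens_cases) (auto simp: fmult_diff_right fspan_def intro!: fv.span_base)
  from r show "fmult (@) r (Poly_Mapping.single v 1) \<in> fspan (word_gens s)"
    using word_gens_intros(1)[of _ _ _ "w @ v" for w] word_gens_intros(2)[of _ _ _ "w @ v" for w]
    by (cases rule: word_gens_cases) (auto simp: fmult_diff_left fspan_def intro!: fv.span_base)
qed auto

lemma tensor_algebra_eq: "tensor_algebra s = W.Q"
  by (simp add: tensor_algebra_def word_rels_eq)

lemma word_eq: "word s w = W.cl (Poly_Mapping.single w 1)"
  by (simp add: word_def word_rels_eq)

lemma kalg_tensor_algebra: "kalg (tensor_algebra s)"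
  unfolding tensor_algebra_eq by (rule W.kalg_Q)

lemma word_closed: "word s w \<in> carrier (tensor_algebra s)"
  unfolding tensor_algebra_eq word_eq by (rule W.cl_closed) simp

lemma word_Nil: "\<one>\<^bsub>tensor_algebra s\<^esub> = word s []"
  unfolding tensor_algebra_eq word_eq by (rule W.cl_one)

lemma word_append: "word s v \<otimes>\<^bsub>tensor_algebra s\<^esub> word s w = word s (v @ w)"
  unfolding tensor_algebra_eq word_eq by (simp add: W.cl_mult)

lemma gen_eq_word: "gen s x = word s [x]"
  by (simp add: gen_def word_def)

lemma word_multilinear: "multilinear s (tensor_algebra s) (word s)"
  using word_gens_intros word_closed
  by (auto simp: multilinear_def tensor_algebra_eq word_eq intro!: W.cl_additivity W.cl_homogeneity)

lemma word_induct [consumes 1, case_names word add smult]: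
  assumes "X \<in> carrier (tensor_algebra s)"
    and "\<And>w. P (word s w)"
    and "\<And>X Y. X \<in> carrier (tensor_algebra s) \<Longrightarrow> Y \<in> carrier (tensor_algebra s) \<Longrightarrow>
      P X \<Longrightarrow> P Y \<Longrightarrow> P (X \<oplus>\<^bsub>tensor_algebra s\<^esub> Y)"
    and "\<And>c X. X \<in> carrier (tensor_algebra s) \<Longrightarrow> P X \<Longrightarrow> P (c \<odot>\<^bsub>tensor_algebra s\<^esub> X)"
  shows "P X"
  using assms unfolding tensor_algebra_eq word_eq by (rule W.Q_induct)

lemma
  assumes M: "kspace M" and g: "multilinear s M g"
  shows induced_multilinear: "linmap (tensor_algebra s) M (induced M g)"
    and induced_word: "induced M g (word s w) = g w"
proof -
  have rel: "lext M g r = \<zero>\<^bsub>M\<^esub>" if "r \<in> word_gens s" for r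
    using that g unfolding multilinear_def
    by (cases rule: word_gens_cases) (auto intro!: lext_additivity[OF M] lext_homogeneity[OF M])
  show "linmap (tensor_algebra s) M (induced M g)" "induced M g (word s w) = g w"
    using W.induced_linmap[OF M _ rel] g by (auto simp: tensor_algebra_eq word_eq multilinear_def)
qed

lemma induced_word_param_linmap:
  assumes "kspace Z" "kspace M" and "\<And>w. linmap Z M (\<lambda>z. F z w)" and "X \<in> carrier (tensor_algebra s)"
  shows "linmap Z M (\<lambda>z. induced M (F z) X)"
  by (rule W.induced_param_linmap) (use assms in \<open>auto simp: tensor_algebra_eq\<close>)

lemma
  assumes A: "kalg A" and closed: "\<And>x. f x \<in> carrier A"
    and add: "\<And>x y. f (x + y) = f x \<oplus>\<^bsub>A\<^esub> f y" and smult: "\<And>c x. f (s c x) = c \<odot>\<^bsub>A\<^esub> f x"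
  shows hom_ext_linmap: "linmap (tensor_algebra s) A (hom_ext A f)"
    and hom_ext_word: "hom_ext A f (word s w) = foldr (\<lambda>x a. f x \<otimes>\<^bsub>A\<^esub> a) w \<one>\<^bsub>A\<^esub>"
proof -
  interpret A: kalg A by fact
  let ?F = "\<lambda>w. foldr (\<lambda>x a. f x \<otimes>\<^bsub>A\<^esub> a) w \<one>\<^bsub>A\<^esub>"
  have F: "?F w \<in> carrier A" for w by (induction w) (auto simp: closed)
  have "?F (w @ [x + y] @ w') = ?F (w @ [x] @ w') \<oplus>\<^bsub>A\<^esub> ?F (w @ [y] @ w')" for w x y w'
  proof (induction w)
    case Nil
    show ?case using F[of w'] by (simp add: add closed A.kalg_l_distr)
  next
    case (Cons z w)
    show ?case using F[of "w @ [x] @ w'"] F[of "w @ [y] @ w'"] Cons by (simp add: closed A.kalg_r_distr)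
  qed
  moreover have "?F (w @ [s c x] @ w') = c \<odot>\<^bsub>A\<^esub> ?F (w @ [x] @ w')" for w x c w'
  proof (induction w)
    case Nil
    show ?case using F[of w'] by (simp add: smult closed A.kalg_smult_l)
  next
    case (Cons z w)
    show ?case using F[of "w @ [x] @ w'"] Cons by (simp add: closed A.kalg_smult_r)
  qed
  ultimately have "multilinear s A ?F" using F unfolding multilinear_def by blast
  from induced_multilinear[OF A.module_axioms this] induced_word[OF A.module_axioms this]
  show "linmap (tensor_algebra s) A (hom_ext A f)"
    and "hom_ext A f (word s w) = foldr (\<lambda>x a. f x \<otimes>\<^bsub>A\<^esub> a) w \<one>\<^bsub>A\<^esub>"
    by (simp_all add: hom_ext_def)
qed

end

section \<open>Comultiplication of words\<close>

text \<open>Sums over lists instead of sets: the same splitting of a word into two subwords can arise more than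
  once when letters are repeated, and each occurrence counts.\<close>

definition lsum :: "('k, 'm) module \<Rightarrow> 'm list \<Rightarrow> 'm" where
  "lsum M xs = foldr (\<lambda>x y. x \<oplus>\<^bsub>M\<^esub> y) xs \<zero>\<^bsub>M\<^esub>"

lemma lsum_simps [simp]: "lsum M [] = \<zero>\<^bsub>M\<^esub>" "lsum M (x # xs) = x \<oplus>\<^bsub>M\<^esub> lsum M xs"
  by (simp_all add: lsum_def)

lemma lsum_scalars [simp]: "lsum scalars xs = sum_list xs"
  by (induction xs) simp_all

lemma lsum_closed:
  assumes "kspace M" shows "set xs \<subseteq> carrier M \<Longrightarrow> lsum M xs \<in> carrier M"
proof -
  interpret M: Module.module scalars M by fact
  show "set xs \<subseteq> carrier M \<Longrightarrow> lsum M xs \<in> carrier M" by (induction xs) simp_all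
qed

lemma lsum_append:
  assumes "kspace M" "set xs \<subseteq> carrier M" "set ys \<subseteq> carrier M"
  shows "lsum M (xs @ ys) = lsum M xs \<oplus>\<^bsub>M\<^esub> lsum M ys"
proof -
  interpret M: Module.module scalars M by fact
  show ?thesis using assms(2,3)
    by (induction xs) (simp_all add: lsum_closed[OF assms(1)] M.add.m_assoc)
qed

lemma linmap_lsum:
  assumes A: "kspace A" and B: "kspace B" and f: "linmap A B f"
  shows "set xs \<subseteq> carrier A \<Longrightarrow> f (lsum A xs) = lsum B (map f xs)"
  by (induction xs) (simp_all add: linmap_zero[OF B A f] linmap_add[OF f] lsum_closed[OF A])

text \<open>The unshuffles of a word: all ways to distribute its letters over two complementary subwords.\<close>

fun splits :: "'a list \<Rightarrow> ('a list \<times> 'a list) list" where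
  "splits [] = [([], [])]"
| "splits (x # w) = map (\<lambda>(a, b). (a, x # b)) (splits w) @ map (\<lambda>(a, b). (x # a, b)) (splits w)"

context
  fixes s :: "'k::field \<Rightarrow> 'u::ab_group_add \<Rightarrow> 'u"
begin

interpretation T: kalg "tensor_algebra s" by (rule kalg_tensor_algebra)
interpretation TT: kalg "tensor_alg (tensor_algebra s) (tensor_algebra s)"
  by (intro kalg_tensor_alg kalg_tensor_algebra)

abbreviation (input) "TensorAlg \<equiv> tensor_algebra s"
abbreviation (input) "TensorSq \<equiv> tensor_alg (tensor_algebra s) (tensor_algebra s)"

text \<open>Multiplying the formula for \<open>w\<close> by \<open>1 \<otimes> x + x \<otimes> 1\<close> puts the new first letter \<open>x\<close> into the right or
  into the left subword, which is the recursion of \<^const>\<open>splits\<close>.\<close>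

lemma
  shows comult_T_linmap: "linmap TensorAlg TensorSq (comult_T s)"
    and comult_T_word: "comult_T s (word s w) =
      lsum TensorSq (map (\<lambda>(a, b). tensor TensorAlg TensorAlg (word s a) (word s b)) (splits w))"
proof -
  let ?t = "tensor TensorAlg TensorAlg"
  let ?f = "\<lambda>x. ?t \<one>\<^bsub>TensorAlg\<^esub> (gen s x) \<oplus>\<^bsub>TensorSq\<^esub> ?t (gen s x) \<one>\<^bsub>TensorAlg\<^esub>"
  note [simp] = tensor_closed[OF kalg_tensor_algebra kalg_tensor_algebra] word_closed
  have gl: "gen s (x + y) = gen s x \<oplus>\<^bsub>TensorAlg\<^esub> gen s y" "gen s (s c x) = c \<odot>\<^bsub>TensorAlg\<^esub> gen s x" for x y c
    using word_multilinear[of s, unfolded multilinear_def, THEN conjunct2, THEN conjunct1, rule_format, of "[]" x y "[]"]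
      word_multilinear[of s, unfolded multilinear_def, THEN conjunct2, THEN conjunct2, rule_format, of "[]" c x "[]"]
    by (simp_all add: gen_eq_word)
  note b = tensor_bilinmap[OF kalg_tensor_algebra kalg_tensor_algebra]
  have gc: "gen s x \<in> carrier TensorAlg" for x by (simp add: gen_eq_word)
  have f1: "?f x \<in> carrier TensorSq" for x by (simp add: gc)
  have f2: "?f (x + y) = ?f x \<oplus>\<^bsub>TensorSq\<^esub> ?f y" for x y
    by (simp add: gc gl linmap_add[OF bilinmap_left[OF b]] linmap_add[OF bilinmap_right[OF b]] TT.add.m_ac)
  have f3: "?f (s c x) = c \<odot>\<^bsub>TensorSq\<^esub> ?f x" for c x
    by (simp add: gc gl linmap_smult[OF bilinmap_left[OF b]] linmap_smult[OF bilinmap_right[OF b]]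
        kspace_simps[OF TT.module_axioms])
  note h = hom_ext_linmap[where s = s and f = ?f, OF TT.kalg_axioms f1 f2 f3] 
    hom_ext_word[where s = s and f = ?f, OF TT.kalg_axioms f1 f2 f3]
  have comult: "comult_T s = hom_ext TensorSq ?f" by (simp add: comult_T_def Let_def)
  show "linmap TensorAlg TensorSq (comult_T s)" unfolding comult by (rule h(1))
  let ?p = "\<lambda>(a, b). ?t (word s a) (word s b)"
  have cl: "set (map ?p xs) \<subseteq> carrier TensorSq" for xs by auto
  have "foldr (\<lambda>x a. ?f x \<otimes>\<^bsub>TensorSq\<^esub> a) w \<one>\<^bsub>TensorSq\<^esub> = lsum TensorSq (map ?p (splits w))"
  proof (induction w)
    case Nil
    show ?case by (simp add: tensor_one[OF kalg_tensor_algebra kalg_tensor_algebra] word_Nil)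
  next
    case (Cons x w)
    let ?xs = "map ?p (splits w)"
    have lin: "linmap TensorSq TensorSq (\<lambda>X. y \<otimes>\<^bsub>TensorSq\<^esub> X)" if "y \<in> carrier TensorSq" for y
      by (rule linmapI) (simp_all add: that TT.kalg_r_distr TT.kalg_smult_r)
    have "foldr (\<lambda>x a. ?f x \<otimes>\<^bsub>TensorSq\<^esub> a) (x # w) \<one>\<^bsub>TensorSq\<^esub> = ?f x \<otimes>\<^bsub>TensorSq\<^esub> lsum TensorSq ?xs"
      using Cons by simp
    also have "\<dots> = ?t \<one>\<^bsub>TensorAlg\<^esub> (gen s x) \<otimes>\<^bsub>TensorSq\<^esub> lsum TensorSq ?xs \<oplus>\<^bsub>TensorSq\<^esub> ?t (gen s x) \<one>\<^bsub>TensorAlg\<^esub> \<otimes>\<^bsub>TensorSq\<^esub> lsum TensorSq ?xs"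
      by (rule TT.kalg_l_distr) (simp_all only: gc T.kalg_one tensor_closed[OF kalg_tensor_algebra kalg_tensor_algebra] lsum_closed[OF TT.module_axioms cl])
    also have "?t \<one>\<^bsub>TensorAlg\<^esub> (gen s x) \<otimes>\<^bsub>TensorSq\<^esub> lsum TensorSq ?xs = lsum TensorSq (map ?p (map (\<lambda>(a, b). (a, x # b)) (splits w)))"
      by (subst linmap_lsum[OF TT.module_axioms TT.module_axioms lin cl])
         (auto simp: gc tensor_mult[OF kalg_tensor_algebra kalg_tensor_algebra] gen_eq_word word_Nil word_append
           intro!: arg_cong[where f = "lsum TensorSq"])
    also have "?t (gen s x) \<one>\<^bsub>TensorAlg\<^esub> \<otimes>\<^bsub>TensorSq\<^esub> lsum TensorSq ?xs = lsum TensorSq (map ?p (map (\<lambda>(a, b). (x # a, b)) (splits w)))"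
      by (subst linmap_lsum[OF TT.module_axioms TT.module_axioms lin cl])
         (auto simp: gc tensor_mult[OF kalg_tensor_algebra kalg_tensor_algebra] gen_eq_word word_Nil word_append
           intro!: arg_cong[where f = "lsum TensorSq"])
    finally show ?case
      unfolding splits.simps map_append lsum_append[OF TT.module_axioms cl cl] .
  qed
  then show "comult_T s (word s w) = lsum TensorSq (map ?p (splits w))"
    unfolding comult h(2) .
qed

end

section \<open>The joint tensor algebra\<close>

definition jword ::
  "('k::field \<Rightarrow> 'u::ab_group_add \<Rightarrow> 'u) \<Rightarrow> ('k \<Rightarrow> 'v::ab_group_add \<Rightarrow> 'v) \<Rightarrow>
    'u list \<Rightarrow> 'v list \<Rightarrow> ('k, 'u, 'v) joint" where
  "jword sU sV u v = joint_tensor sU sV (word sU u) (word sV v)"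

locale joint_tensor_algebra =
  fixes sU :: "'k::field \<Rightarrow> 'u::ab_group_add \<Rightarrow> 'u" and sV :: "'k \<Rightarrow> 'v::ab_group_add \<Rightarrow> 'v"
begin

abbreviation "TU \<equiv> tensor_algebra sU"
abbreviation "TV \<equiv> tensor_algebra sV"
abbreviation "H \<equiv> joint_algebra sU sV"
abbreviation "HH \<equiv> tensor_alg H H"

lemmas kalg_TU = kalg_tensor_algebra[of sU] and kalg_TV = kalg_tensor_algebra[of sV]

lemma kalg_joint: "kalg H"
  unfolding joint_algebra_def by (intro kalg_tensor_alg kalg_tensor_algebra)

sublocale TU: kalg TU by (rule kalg_TU)
sublocale TV: kalg TV by (rule kalg_TV)
sublocale H: kalg H by (rule kalg_joint)
sublocale HH: kalg HH by (intro kalg_tensor_alg kalg_joint)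

lemma joint_tensor_bilinmap: "bilinmap TU TV H (joint_tensor sU sV)"
  unfolding joint_algebra_def joint_tensor_def by (rule tensor_bilinmap[OF kalg_TU kalg_TV])

lemma jword_closed [simp]: "jword sU sV u v \<in> carrier H"
  unfolding jword_def by (rule bilinmap_closed[OF joint_tensor_bilinmap word_closed word_closed])

lemma jword_Nil: "\<one>\<^bsub>H\<^esub> = jword sU sV [] []"
  by (simp add: joint_algebra_def tensor_one[OF kalg_TU kalg_TV] jword_def joint_tensor_def word_Nil)

lemma jword_append: "jword sU sV u v \<otimes>\<^bsub>H\<^esub> jword sU sV u' v' = jword sU sV (u @ u') (v @ v')"
  by (simp add: joint_algebra_def tensor_mult[OF kalg_TU kalg_TV] jword_def joint_tensor_def
      word_append word_closed)

lemma emb_eq_jword: "emb_U sU sV x = jword sU sV [x] []" "emb_V sU sV y = jword sU sV [] [y]"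
  by (simp_all add: emb_U_def emb_V_def jword_def gen_eq_word word_Nil)

lemma joint_induct [consumes 1, case_names jword add smult]:
  assumes X: "X \<in> carrier H"
    and jword: "\<And>u v. P (jword sU sV u v)"
    and add: "\<And>X Y. X \<in> carrier H \<Longrightarrow> Y \<in> carrier H \<Longrightarrow> P X \<Longrightarrow> P Y \<Longrightarrow> P (X \<oplus>\<^bsub>H\<^esub> Y)"
    and smult: "\<And>c X. X \<in> carrier H \<Longrightarrow> P X \<Longrightarrow> P (c \<odot>\<^bsub>H\<^esub> X)"
  shows "P X"
proof -
  note b = joint_tensor_bilinmap
  have 1: "P (joint_tensor sU sV (word sU u) B)" if "B \<in> carrier TV" for u B
    using that
    by (induction rule: word_induct)
       (auto simp: linmap_add[OF bilinmap_right[OF b]] linmap_smult[OF bilinmap_right[OF b]] word_closed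
         intro!: jword[unfolded jword_def] add smult bilinmap_closed[OF b])
  have 2: "P (joint_tensor sU sV A B)" if "A \<in> carrier TU" "B \<in> carrier TV" for A B
    using that(1)
    by (induction rule: word_induct)
       (auto simp: linmap_add[OF bilinmap_left[OF b]] linmap_smult[OF bilinmap_left[OF b]] that(2)
         intro!: 1 add smult bilinmap_closed[OF b])
  show ?thesis
    by (rule tensor_induct[OF kalg_TU kalg_TV X[unfolded joint_algebra_def]])
       (use 2 add smult in \<open>auto simp: joint_algebra_def joint_tensor_def\<close>)
qed

text \<open>Most identities below are multilinear; this rule reduces them to words, one argument at a time.\<close>

lemma linmap_joint_eqI:
  assumes f: "linmap H M f" and g: "linmap H M g"
    and eq: "\<And>u v. f (jword sU sV u v) = g (jword sU sV u v)" and X: "X \<in> carrier H"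
  shows "f X = g X"
  using X
  by (induction rule: joint_induct)
     (simp_all add: eq linmap_add[OF f] linmap_add[OF g] linmap_smult[OF f] linmap_smult[OF g])

text \<open>The comultiplication of the joint algebra consists of three nested Sweedler sums.  The summand of each
  is bilinear in the two factors that it runs over, so each can be evaluated on words.\<close>

lemma
  shows comult_joint_linmap: "linmap H HH (comult_joint sU sV)"
    and comult_joint_jword: "comult_joint sU sV (jword sU sV u v) =
      lsum HH (map (\<lambda>(a, a'). lsum HH (map (\<lambda>(b, b').
        tensor H H (jword sU sV a b) (jword sU sV a' b')) (splits v))) (splits u))"
proof -
  let ?t = "joint_tensor sU sV" and ?T = "tensor H H"
  let ?K = "\<lambda>B u1 u2. sweedler HH (\<lambda>v1 v2. ?T (?t u1 v1) (?t u2 v2)) (comult_T sV B)"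
  let ?G = "\<lambda>A B. sweedler HH (?K B) (comult_T sU A)"
  have comult: "comult_joint sU sV = sweedler HH ?G"
    by (simp add: comult_joint_def Let_def)
  note t = joint_tensor_bilinmap and T = tensor_bilinmap[OF kalg_joint kalg_joint]
  note cU = comult_T_linmap[of sU] and cV = comult_T_linmap[of sV]
  note tc = bilinmap_closed[OF t]
  have 1: "bilinmap TV TV HH (\<lambda>v1 v2. ?T (?t u1 v1) (?t u2 v2))"
    if "u1 \<in> carrier TU" "u2 \<in> carrier TU" for u1 u2
    by (intro bilinmapI linmap_compose[OF bilinmap_right[OF t] bilinmap_right[OF T]]
         linmap_compose[OF bilinmap_right[OF t] bilinmap_left[OF T]] that tc)
  have 2: "bilinmap TU TU HH (?K B)" if "B \<in> carrier TV" for B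
    by (intro bilinmapI sweedler_param_linmap[OF kalg_TV kalg_TV] TU.module_axioms HH.module_axioms
         linmap_compose[OF bilinmap_left[OF t] bilinmap_right[OF T]]
         linmap_compose[OF bilinmap_left[OF t] bilinmap_left[OF T]] linmap_closed[OF cV] that tc)
  have 3: "bilinmap TU TV HH ?G"
    by (intro bilinmapI sweedler_param_linmap[OF kalg_TU kalg_TU] TV.module_axioms HH.module_axioms
         linmap_compose[OF cU sweedler_linmap[OF kalg_TU kalg_TU HH.module_axioms 2]]
         linmap_compose[OF cV sweedler_linmap[OF kalg_TV kalg_TV HH.module_axioms 1]]
         linmap_closed[OF cU])
  show "linmap H HH (comult_joint sU sV)"
    unfolding comult using sweedler_linmap[OF kalg_TU kalg_TV HH.module_axioms 3]
    by (simp add: joint_algebra_def)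
  have K: "?K (word sV v) (word sU a) (word sU a') =
      lsum HH (map (\<lambda>(b, b'). ?T (jword sU sV a b) (jword sU sV a' b')) (splits v))" for a a'
  proof -
    note s = 1[OF word_closed[of sU a] word_closed[of sU a']]
    show ?thesis
      unfolding comult_T_word
      by (subst linmap_lsum[OF _ HH.module_axioms sweedler_linmap[OF kalg_TV kalg_TV HH.module_axioms s]])
         (auto simp: tensor_closed[OF kalg_TV kalg_TV] word_closed jword_def
            sweedler_tensor[OF kalg_TV kalg_TV HH.module_axioms s] kalg.axioms(1)[OF kalg_tensor_alg[OF kalg_TV kalg_TV]]
            intro!: arg_cong[where f = "lsum HH"])
  qed
  have G: "?G (word sU u) (word sV v) = lsum HH (map (\<lambda>(a, a'). ?K (word sV v) (word sU a) (word sU a')) (splits u))"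
  proof -
    note s = 2[OF word_closed[of sV v]]
    show ?thesis
      unfolding comult_T_word[of sU]
      by (subst linmap_lsum[OF _ HH.module_axioms sweedler_linmap[OF kalg_TU kalg_TU HH.module_axioms s]])
         (auto simp: tensor_closed[OF kalg_TU kalg_TU] word_closed jword_def
            sweedler_tensor[OF kalg_TU kalg_TU HH.module_axioms s] kalg.axioms(1)[OF kalg_tensor_alg[OF kalg_TU kalg_TU]]
            intro!: arg_cong[where f = "lsum HH"])
  qed
  have "comult_joint sU sV (jword sU sV u v) = ?G (word sU u) (word sV v)"
    unfolding comult jword_def joint_tensor_def[THEN fun_cong, THEN fun_cong, of sU sV "word sU u" "word sV v"]
    by (rule sweedler_tensor[OF kalg_TU kalg_TV HH.module_axioms 3 word_closed word_closed])
  then show "comult_joint sU sV (jword sU sV u v) =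
      lsum HH (map (\<lambda>(a, a'). lsum HH (map (\<lambda>(b, b').
        ?T (jword sU sV a b) (jword sU sV a' b')) (splits v))) (splits u))"
    by (simp only: G K)
qed

lemma sweedler_comult_jword:
  assumes f: "bilinmap H H scalars f"
  shows "sweedler scalars f (comult_joint sU sV (jword sU sV u v)) =
    (\<Sum>(a, a')\<leftarrow>splits u. \<Sum>(b, b')\<leftarrow>splits v. f (jword sU sV a b) (jword sU sV a' b'))"
proof -
  note l = sweedler_linmap[OF kalg_joint kalg_joint kspace_scalars f]
  note s = linmap_lsum[OF HH.module_axioms kspace_scalars l]
  note c = tensor_closed[OF kalg_joint kalg_joint jword_closed jword_closed]
  have inner: "sweedler scalars f (lsum HH (map (\<lambda>(b, b').
        tensor H H (jword sU sV a b) (jword sU sV a' b')) (splits v))) =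
      (\<Sum>(b, b')\<leftarrow>splits v. f (jword sU sV a b) (jword sU sV a' b'))" for a a'
    by (subst s) (auto simp: c sweedler_tensor[OF kalg_joint kalg_joint kspace_scalars f]
        intro!: arg_cong[where f = sum_list])
  show ?thesis
    unfolding comult_joint_jword
    by (subst s) (auto simp: c inner
      intro!: arg_cong[where f = sum_list] lsum_closed[OF HH.module_axioms])
qed

end

section \<open>Permanents and their Laplace expansions\<close>

fun removals :: "'a list \<Rightarrow> ('a \<times> 'a list) list" where
  "removals [] = []"
| "removals (x # w) = (x, w) # map (\<lambda>(y, r). (y, x # r)) (removals w)"

text \<open>The permanent of the matrix with rows indexed by \<open>u\<close>, columns indexed by \<open>v\<close> and entries
  \<open>d x y\<close>, by expansion along the first row.  A matrix that is not square has permanent \<open>0\<close>.\<close>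

fun permanent :: "('u \<Rightarrow> 'v \<Rightarrow> 'k::field) \<Rightarrow> 'u list \<Rightarrow> 'v list \<Rightarrow> 'k" where
  "permanent d [] v = (if v = [] then 1 else 0)"
| "permanent d (x # u) v = (\<Sum>(y, r)\<leftarrow>removals v. d x y * permanent d u r)"

lemma sum_list_swap:
  fixes f :: "'a \<Rightarrow> 'b \<Rightarrow> 'c::comm_monoid_add"
  shows "(\<Sum>x\<leftarrow>xs. \<Sum>y\<leftarrow>ys. f x y) = (\<Sum>y\<leftarrow>ys. \<Sum>x\<leftarrow>xs. f x y)"
  by (induction xs) (simp_all add: sum_list_addf)

lemma removals_append:
  "removals (v @ w) = map (\<lambda>(y, r). (y, r @ w)) (removals v) @ map (\<lambda>(y, r). (y, v @ r)) (removals w)"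
  by (induction v) (simp_all add: case_prod_beta' comp_def)

text \<open>Laplace expansion along a block of columns.  In the induction step the letter \<open>x\<close> is matched with a
  letter of \<open>v\<close> or with one of \<open>v'\<close>; accordingly it belongs to the left or to the right subword.\<close>

lemma permanent_append_right:
  "permanent d u (v @ v') = (\<Sum>(a, b)\<leftarrow>splits u. permanent d a v * permanent d b v')"
proof (induction u arbitrary: v v')
  case Nil
  show ?case by simp
next
  case (Cons x u)
  have "permanent d (x # u) (v @ v') =
      (\<Sum>q\<leftarrow>removals v. \<Sum>p\<leftarrow>splits u. d x (fst q) * (permanent d (fst p) (snd q) * permanent d (snd p) v')) +
      (\<Sum>q\<leftarrow>removals v'. \<Sum>p\<leftarrow>splits u. d x (fst q) * (permanent d (fst p) v * permanent d (snd p) (snd q)))"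
    by (simp add: removals_append case_prod_beta' comp_def Cons.IH flip: sum_list_const_mult)
  also have "\<dots> =
      (\<Sum>p\<leftarrow>splits u. \<Sum>q\<leftarrow>removals v. d x (fst q) * (permanent d (fst p) (snd q) * permanent d (snd p) v')) +
      (\<Sum>p\<leftarrow>splits u. \<Sum>q\<leftarrow>removals v'. d x (fst q) * (permanent d (fst p) v * permanent d (snd p) (snd q)))"
    by (subst (1 2) sum_list_swap) (rule refl)
  also have "\<dots> = (\<Sum>(a, b)\<leftarrow>splits (x # u). permanent d a v * permanent d b v')"
    by (simp add: case_prod_beta' comp_def mult_ac add_ac flip: sum_list_const_mult sum_list_mult_const)
  finally show ?case .
qed

text \<open>Both sides sum over all ways to distribute the letters of \<open>v\<close> over a distinguished letter and two
  complementary subwords.\<close>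

lemma removals_splits:
  fixes F :: "'a \<Rightarrow> 'a list \<Rightarrow> 'a list \<Rightarrow> 'k::comm_monoid_add"
  shows "(\<Sum>(y, r)\<leftarrow>removals v. \<Sum>(a, b)\<leftarrow>splits r. F y a b) =
    (\<Sum>(c, b)\<leftarrow>splits v. \<Sum>(y, a)\<leftarrow>removals c. F y a b)"
proof (induction v arbitrary: F)
  case (Cons z v)
  then show ?case
    using Cons.IH[of "\<lambda>y a b. F y a (z # b)"] Cons.IH[of "\<lambda>y a b. F y (z # a) b"]
    by (simp add: case_prod_beta' comp_def sum_list_addf add_ac)
qed simp

lemma splits_fst_Nil:
  fixes F :: "'a list \<Rightarrow> 'k::comm_monoid_add"
  shows "(\<Sum>(a, b)\<leftarrow>splits v. if a = [] then F b else 0) = F v"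
proof (induction v arbitrary: F)
  case (Cons z v)
  then show ?case using Cons.IH[of "\<lambda>b. F (z # b)"] by (simp add: case_prod_beta' comp_def cong: if_cong)
qed simp

text \<open>Laplace expansion along a block of rows.  As the recursion runs along rows, the induction step only has
  to exchange the expansion along the row of \<open>x\<close> with the choice of the columns for \<open>u\<close>, which is
  \<open>removals_splits\<close>.\<close>

lemma permanent_append_left:
  "permanent d (u @ u') v = (\<Sum>(a, b)\<leftarrow>splits v. permanent d u a * permanent d u' b)"
proof (induction u arbitrary: v)
  case Nil
  have "(\<Sum>(a, b)\<leftarrow>splits v. permanent d [] a * permanent d u' b) =
      (\<Sum>(a, b)\<leftarrow>splits v. if a = [] then permanent d u' b else 0)"
    by (intro arg_cong[where f = sum_list] map_cong) auto
  then show ?case by (simp only: splits_fst_Nil append_Nil)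
next
  case (Cons x u)
  then show ?case
    using removals_splits[of "\<lambda>y a b. d x y * (permanent d u a * permanent d u' b)" v]
    by (simp add: case_prod_beta' mult.assoc flip: sum_list_const_mult sum_list_mult_const)
qed

lemma permanent_singletons:
  "permanent d [x] v = (case v of [y] \<Rightarrow> d x y | _ \<Rightarrow> 0)"
  "permanent d u [y] = (case u of [x] \<Rightarrow> d x y | _ \<Rightarrow> 0)"
proof -
  \<comment> \<open>With at least two columns, one of them is left over after a removal.\<close>
  have nz: "snd p \<noteq> []" if "p \<in> set (removals (y # z # w))" for p :: "'b \<times> 'b list" and y z w
    using that by auto
  show "permanent d [x] v = (case v of [y] \<Rightarrow> d x y | _ \<Rightarrow> 0)"
  proof (cases v)
    case (Cons y w)
    then show ?thesis
    proof (cases w)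
      case (Cons z w')
      have "map (\<lambda>(y, r). d x y * permanent d [] r) (removals (y # z # w')) = map (\<lambda>_. 0) (removals (y # z # w'))"
        by (rule map_cong[OF refl]) (use nz in fastforce)
      then have "permanent d [x] (y # z # w') = (\<Sum>_\<leftarrow>removals (y # z # w'). 0)"
        by (simp only: permanent.simps)
      then show ?thesis using \<open>v = y # w\<close> Cons by (simp only: sum_list_0 list.case)
    qed simp
  qed simp
  show "permanent d u [y] = (case u of [x] \<Rightarrow> d x y | _ \<Rightarrow> 0)"
    by (cases u; cases "tl u") auto
qed

context
  fixes sU :: "'k::field \<Rightarrow> 'u::ab_group_add \<Rightarrow> 'u" and sV :: "'k \<Rightarrow> 'v::ab_group_add \<Rightarrow> 'v"
    and d :: "'u \<Rightarrow> 'v \<Rightarrow> 'k"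
  assumes d: "\<And>x x' y. d (x + x') y = d x y + d x' y" "\<And>c x y. d (sU c x) y = c * d x y"
    "\<And>x y y'. d x (y + y') = d x y + d x y'" "\<And>c x y. d x (sV c y) = c * d x y"
begin

text \<open>The Laplace expansion isolates the letter in question as a matrix with a single row, and
  such a permanent is an entry or \<open>0\<close>.\<close>

lemma permanent_multilinear_left: "multilinear sU scalars (\<lambda>u. permanent d u v)"
proof -
  have "permanent d [x + y] v = permanent d [x] v + permanent d [y] v"
    "permanent d [sU c x] v = c * permanent d [x] v" for x y c v
    unfolding permanent_singletons by (auto simp: d split: list.splits)
  then show ?thesis
    unfolding multilinear_def permanent_append_left
    by (simp add: case_prod_beta' distrib_left distrib_right sum_list_addf mult_ac del: permanent.simps
        flip: sum_list_const_mult)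
qed

lemma permanent_multilinear_right: "multilinear sV scalars (\<lambda>v. permanent d u v)"
proof -
  have "permanent d u [x + y] = permanent d u [x] + permanent d u [y]"
    "permanent d u [sV c x] = c * permanent d u [x]" for x y c u
    unfolding permanent_singletons by (auto simp: d split: list.splits)
  then show ?thesis
    unfolding multilinear_def permanent_append_right
    by (simp add: case_prod_beta' distrib_left distrib_right sum_list_addf mult_ac del: permanent.simps
        flip: sum_list_const_mult)
qed

end

section \<open>The permanent pairing\<close>

lemma linmap_scalars_mult_left: "linmap A scalars f \<Longrightarrow> linmap A scalars (\<lambda>x. c * f x)"
  by (auto simp: linmap_def algebra_simps)

lemma linmap_scalars_mult_right: "linmap A scalars f \<Longrightarrow> linmap A scalars (\<lambda>x. f x * (c :: 'k::field))"
  using linmap_scalars_mult_left[of A f c] by (simp add: mult.commute)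

lemma linmap_mult_left: "kalg A \<Longrightarrow> a \<in> carrier A \<Longrightarrow> linmap A A (\<lambda>x. a \<otimes>\<^bsub>A\<^esub> x)"
  by (intro linmapI) (simp_all add: kalg.kalg_mult kalg.kalg_r_distr kalg.kalg_smult_r)

lemma linmap_mult_right: "kalg A \<Longrightarrow> a \<in> carrier A \<Longrightarrow> linmap A A (\<lambda>x. x \<otimes>\<^bsub>A\<^esub> a)"
  by (intro linmapI) (simp_all add: kalg.kalg_mult kalg.kalg_l_distr kalg.kalg_smult_l)

definition tensor_pairing ::
  "('u \<Rightarrow> 'v \<Rightarrow> 'k::field) \<Rightarrow> ('u list \<Rightarrow>\<^sub>0 'k) set \<Rightarrow> ('v list \<Rightarrow>\<^sub>0 'k) set \<Rightarrow> 'k" where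
  "tensor_pairing d A B = induced scalars (\<lambda>u. induced scalars (permanent d u) B) A"

definition joint_pairing ::
  "('u \<Rightarrow> 'v \<Rightarrow> 'k::field) \<Rightarrow> ('k, 'u, 'v) joint \<Rightarrow> ('k, 'u, 'v) joint \<Rightarrow> 'k" where
  "joint_pairing d X Y =
     sweedler scalars (\<lambda>A B. sweedler scalars (\<lambda>A' B'. tensor_pairing d A B' * tensor_pairing d A' B) Y) X"

lemma bilinear_form_bilinmap:
  assumes "bilinear_form A P" shows "bilinmap A A scalars (\<lambda>a b. P (a, b))"
  using assms by (auto simp: bilinear_form_def bilinmap_def linmap_def)

context joint_tensor_algebra
begin

lemma laplace_integrand_bilinmap:
  assumes f: "bilinmap H H scalars f" and "b \<in> carrier H" "c \<in> carrier H"
  shows "bilinmap H H scalars (\<lambda>a1 a2. f a1 b * f a2 c)"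
  by (intro bilinmapI linmap_scalars_mult_left linmap_scalars_mult_right bilinmap_left[OF f] assms)

end

locale duality_form = joint_tensor_algebra sU sV
  for sU :: "'k::field \<Rightarrow> 'u::ab_group_add \<Rightarrow> 'u" and sV :: "'k \<Rightarrow> 'v::ab_group_add \<Rightarrow> 'v" +
  fixes d :: "'u \<Rightarrow> 'v \<Rightarrow> 'k"
  assumes d: "\<And>x x' y. d (x + x') y = d x y + d x' y" "\<And>c x y. d (sU c x) y = c * d x y"
    "\<And>x y y'. d x (y + y') = d x y + d x y'" "\<And>c x y. d x (sV c y) = c * d x y"
begin

lemma induced_permanent_linmap: "linmap TV scalars (induced scalars (permanent d u))"
  by (rule induced_multilinear[OF kspace_scalars permanent_multilinear_right]) (fact d)+

lemma induced_permanent_word: "induced scalars (permanent d u) (word sV v) = permanent d u v"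
  by (rule induced_word[OF kspace_scalars permanent_multilinear_right]) (fact d)+

text \<open>For a fixed element \<open>B\<close> both sides of each law are linear in \<open>B\<close>, so it suffices to take a word.\<close>

lemma induced_permanent_multilinear:
  assumes B: "B \<in> carrier TV"
  shows "multilinear sU scalars (\<lambda>u. induced scalars (permanent d u) B)"
proof -
  note m = permanent_multilinear_left[where d = d and sU = sU and sV = sV, OF d, unfolded multilinear_def scalars_simps]
  have "induced scalars (permanent d (w @ [x + y] @ w')) B =
      induced scalars (permanent d (w @ [x] @ w')) B + induced scalars (permanent d (w @ [y] @ w')) B" for w x y w'
    using B
  proof (induction rule: word_induct)
    case (word v)
    show ?case unfolding induced_permanent_word using m by blast
  qed (simp_all only: linmap_add[OF induced_permanent_linmap] linmap_smult[OF induced_permanent_linmap] scalars_simps algebra_simps)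
  moreover have "induced scalars (permanent d (w @ [sU c x] @ w')) B =
      c * induced scalars (permanent d (w @ [x] @ w')) B" for w x c w'
    using B
  proof (induction rule: word_induct)
    case (word v)
    show ?case unfolding induced_permanent_word using m by blast
  qed (simp_all only: linmap_add[OF induced_permanent_linmap] linmap_smult[OF induced_permanent_linmap] scalars_simps algebra_simps)
  ultimately show ?thesis by (simp add: multilinear_def)
qed

lemma tensor_pairing_bilinmap: "bilinmap TU TV scalars (tensor_pairing d)"
  unfolding tensor_pairing_def
  by (intro bilinmapI induced_word_param_linmap[where s = sU] TV.module_axioms kspace_scalars induced_permanent_linmap
      induced_multilinear[OF kspace_scalars induced_permanent_multilinear])

lemma tensor_pairing_word: "tensor_pairing d (word sU u) (word sV v) = permanent d u v"
  unfolding tensor_pairing_def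
  by (subst induced_word[OF kspace_scalars induced_permanent_multilinear[OF word_closed]]) (rule induced_permanent_word)

lemma joint_pairing_inner_bilinmap:
  assumes "A \<in> carrier TU" "B \<in> carrier TV"
  shows "bilinmap TU TV scalars (\<lambda>A' B'. tensor_pairing d A B' * tensor_pairing d A' B)"
  by (intro bilinmapI linmap_scalars_mult_left linmap_scalars_mult_right
      bilinmap_left[OF tensor_pairing_bilinmap] bilinmap_right[OF tensor_pairing_bilinmap] assms)

lemma joint_pairing_outer_bilinmap:
  assumes Y: "Y \<in> carrier H"
  shows "bilinmap TU TV scalars
    (\<lambda>A B. sweedler scalars (\<lambda>A' B'. tensor_pairing d A B' * tensor_pairing d A' B) Y)"
  by (intro bilinmapI sweedler_param_linmap[OF kalg_TU kalg_TV]
      TU.module_axioms TV.module_axioms kspace_scalars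
      linmap_scalars_mult_left linmap_scalars_mult_right Y[unfolded joint_algebra_def]
      bilinmap_left[OF tensor_pairing_bilinmap] bilinmap_right[OF tensor_pairing_bilinmap])

lemma joint_pairing_bilinmap: "bilinmap H H scalars (joint_pairing d)"
proof (rule bilinmapI)
  fix Y assume "Y \<in> carrier H"
  from sweedler_linmap[OF kalg_tensor_algebra kalg_tensor_algebra kspace_scalars joint_pairing_outer_bilinmap[OF this]]
  show "linmap H scalars (\<lambda>X. joint_pairing d X Y)"
    unfolding joint_pairing_def joint_algebra_def by simp
next
  fix X assume X: "X \<in> carrier H"
  show "linmap H scalars (joint_pairing d X)"
    unfolding joint_pairing_def[abs_def]
    by (rule sweedler_param_linmap[OF kalg_TU kalg_TV
        H.module_axioms kspace_scalars _ X[unfolded joint_algebra_def]])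
       (use sweedler_linmap[OF kalg_tensor_algebra kalg_tensor_algebra kspace_scalars joint_pairing_inner_bilinmap]
        in \<open>simp add: joint_algebra_def\<close>)
qed

lemma joint_pairing_jword:
  "joint_pairing d (jword sU sV u v) (jword sU sV u' v') = permanent d u v' * permanent d u' v"
proof -
  note s = sweedler_tensor[OF kalg_tensor_algebra kalg_tensor_algebra kspace_scalars]
  have "joint_pairing d (jword sU sV u v) (jword sU sV u' v') =
      sweedler scalars (\<lambda>A' B'. tensor_pairing d (word sU u) B' * tensor_pairing d A' (word sV v)) (jword sU sV u' v')"
    unfolding joint_pairing_def
    by (subst (2) jword_def, unfold joint_tensor_def, rule s[OF joint_pairing_outer_bilinmap]) (simp_all add: word_closed)
  also have "\<dots> = tensor_pairing d (word sU u) (word sV v') * tensor_pairing d (word sU u') (word sV v)"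
    unfolding jword_def joint_tensor_def by (rule s[OF joint_pairing_inner_bilinmap]) (simp_all add: word_closed)
  finally show ?thesis by (simp add: tensor_pairing_word)
qed

lemma joint_pairing_sym:
  assumes "X \<in> carrier H" "Y \<in> carrier H"
  shows "joint_pairing d X Y = joint_pairing d Y X"
proof (rule linmap_joint_eqI[OF bilinmap_left[OF joint_pairing_bilinmap] bilinmap_right[OF joint_pairing_bilinmap]])
  fix u v
  show "joint_pairing d (jword sU sV u v) Y = joint_pairing d Y (jword sU sV u v)"
    by (rule linmap_joint_eqI[OF bilinmap_right[OF joint_pairing_bilinmap] bilinmap_left[OF joint_pairing_bilinmap]])
       (simp_all add: joint_pairing_jword assms)
qed (use assms in auto)

text \<open>Both sides are linear in each of \<open>a\<close>, \<open>b\<close> and \<open>c\<close>.  On words, the left-hand side is a product of two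
  permanents, each of a concatenation with a single word, and the two Laplace expansions turn it
  into the double sum over splittings on the right-hand side.\<close>

lemma joint_pairing_laplace:
  assumes a: "a \<in> carrier H" and b: "b \<in> carrier H" and c: "c \<in> carrier H"
  shows "joint_pairing d a (b \<otimes>\<^bsub>H\<^esub> c) =
    sweedler scalars (\<lambda>a1 a2. joint_pairing d a1 b * joint_pairing d a2 c) (comult_joint sU sV a)"
proof -
  let ?P = "joint_pairing d" and ?j = "jword sU sV" and ?D = "comult_joint sU sV"
  let ?R = "\<lambda>a b c. sweedler scalars (\<lambda>a1 a2. ?P a1 b * ?P a2 c) (?D a)"
  note P = joint_pairing_bilinmap and D = comult_joint_linmap
  have Ra: "linmap H scalars (\<lambda>a. ?R a b c)" if "b \<in> carrier H" "c \<in> carrier H" for b c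
    by (rule linmap_compose[OF D sweedler_linmap[OF kalg_joint kalg_joint kspace_scalars laplace_integrand_bilinmap[OF P that]]])
  have Rb: "linmap H scalars (\<lambda>b. ?R a b c)" if "a \<in> carrier H" "c \<in> carrier H" for a c
    by (intro sweedler_param_linmap[OF kalg_joint kalg_joint] H.module_axioms kspace_scalars
        linmap_scalars_mult_right bilinmap_right[OF P] linmap_closed[OF D] that)
  have Rc: "linmap H scalars (\<lambda>c. ?R a b c)" if "a \<in> carrier H" "b \<in> carrier H" for a b
    by (intro sweedler_param_linmap[OF kalg_joint kalg_joint] H.module_axioms kspace_scalars
        linmap_scalars_mult_left bilinmap_right[OF P] linmap_closed[OF D] that)
  have mono: "?P (?j u v) (?j u1 v1 \<otimes>\<^bsub>H\<^esub> ?j u2 v2) = ?R (?j u v) (?j u1 v1) (?j u2 v2)" for u v u1 v1 u2 v2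
    by (subst sweedler_comult_jword[OF laplace_integrand_bilinmap[OF P jword_closed jword_closed]])
       (simp add: jword_append joint_pairing_jword permanent_append_left permanent_append_right
         case_prod_beta' mult_ac flip: sum_list_const_mult sum_list_mult_const, rule sum_list_swap)
  have 1: "?P (?j u v) (?j u1 v1 \<otimes>\<^bsub>H\<^esub> c) = ?R (?j u v) (?j u1 v1) c" for u v u1 v1
    by (rule linmap_joint_eqI[OF linmap_compose[OF linmap_mult_left[OF kalg_joint] bilinmap_right[OF P]] Rc _ c])
       (simp_all add: mono)
  have 2: "?P (?j u v) (b \<otimes>\<^bsub>H\<^esub> c) = ?R (?j u v) b c" for u v
    by (rule linmap_joint_eqI[OF linmap_compose[OF linmap_mult_right[OF kalg_joint] bilinmap_right[OF P]] Rb _ b])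
       (simp_all add: 1 c)
  show ?thesis
    by (rule linmap_joint_eqI[OF bilinmap_left[OF P] Ra _ a]) (simp_all add: 2 b c)
qed

text \<open>The restriction to the carrier makes the form extensional, as the notion of a bilinear form demands.\<close>

lemma laplace_pairing_exists:
  "\<exists>P. laplace_pairing sU sV P \<and> compatible_with sU sV d P"
proof (intro exI conjI)
  let ?P = "restrict (\<lambda>(X, Y). joint_pairing d X Y) (carrier H \<times> carrier H)"
  note P = joint_pairing_bilinmap
  have "bilinear_form H ?P"
    by (auto simp: bilinear_form_def kspace_simps[OF H.module_axioms]
        linmap_add[OF bilinmap_left[OF P]] linmap_add[OF bilinmap_right[OF P]]
        linmap_smult[OF bilinmap_left[OF P]] linmap_smult[OF bilinmap_right[OF P]])
  moreover have "symmetric_form H ?P"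
    by (auto simp: symmetric_form_def joint_pairing_sym)
  moreover have "?P (a, b \<otimes>\<^bsub>H\<^esub> c) = sweedler scalars (\<lambda>a1 a2. ?P (a1, b) * ?P (a2, c)) (comult_joint sU sV a)"
    if "a \<in> carrier H" "b \<in> carrier H" "c \<in> carrier H" for a b c
  proof -
    have "sweedler scalars (\<lambda>a1 a2. joint_pairing d a1 b * joint_pairing d a2 c) (comult_joint sU sV a) =
        sweedler scalars (\<lambda>a1 a2. ?P (a1, b) * ?P (a2, c)) (comult_joint sU sV a)"
      by (rule sweedler_cong[OF kalg_joint kalg_joint kspace_scalars laplace_integrand_bilinmap[OF P that(2,3)]])
         (use that linmap_closed[OF comult_joint_linmap that(1)] in simp_all)
    then show ?thesis using joint_pairing_laplace[OF that] that by simp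
  qed
  ultimately show "laplace_pairing sU sV ?P"
    unfolding laplace_pairing_def Let_def by blast
  show "compatible_with sU sV d ?P"
    by (simp add: compatible_with_def emb_eq_jword jword_Nil joint_pairing_jword)
qed

end

section \<open>Uniqueness\<close>

context joint_tensor_algebra
begin

lemma laplace_pairing_sweedler:
  assumes "laplace_pairing sU sV P" "a \<in> carrier H" "b \<in> carrier H" "c \<in> carrier H"
  shows "P (a, b \<otimes>\<^bsub>H\<^esub> c) = sweedler scalars (\<lambda>a1 a2. P (a1, b) * P (a2, c)) (comult_joint sU sV a)"
  using assms by (simp add: laplace_pairing_def Let_def)

lemma laplace_pairing_bilinmap:
  "laplace_pairing sU sV P \<Longrightarrow> bilinmap H H scalars (\<lambda>a b. P (a, b))"
  by (simp add: laplace_pairing_def Let_def bilinear_form_bilinmap)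

lemma laplace_pairing_sym:
  "laplace_pairing sU sV P \<Longrightarrow> a \<in> carrier H \<Longrightarrow> b \<in> carrier H \<Longrightarrow> P (a, b) = P (b, a)"
  by (simp add: laplace_pairing_def symmetric_form_def Let_def)

text \<open>The generators \<open>x \<otimes> 1\<close> and \<open>1 \<otimes> y\<close>, whose comultiplication is \<open>1 \<otimes> g + g \<otimes> 1\<close>.\<close>

definition primitive_gens :: "('k, 'u, 'v) joint set" where
  "primitive_gens = range (emb_U sU sV) \<union> range (emb_V sU sV)"

lemma primitive_gens_closed: "g \<in> primitive_gens \<Longrightarrow> g \<in> carrier H"
  by (auto simp: primitive_gens_def emb_eq_jword)

text \<open>A pair of words is the product of its letters: first the letters from \<open>U\<close>, then those from \<open>V\<close>.\<close>

lemma jword_gens_induct [case_names one gen]: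
  assumes "P \<one>\<^bsub>H\<^esub>"
    and "\<And>g X. g \<in> primitive_gens \<Longrightarrow> X \<in> carrier H \<Longrightarrow> P X \<Longrightarrow> P (g \<otimes>\<^bsub>H\<^esub> X)"
  shows "P (jword sU sV u v)"
proof (induction u)
  case Nil
  show ?case
  proof (induction v)
    case Nil
    then show ?case using assms(1) by (simp add: jword_Nil)
  next
    case (Cons y v)
    from assms(2)[OF _ _ Cons, of "emb_V sU sV y"] show ?case
      by (simp add: primitive_gens_def emb_eq_jword jword_append)
  qed
next
  case (Cons x u)
  from assms(2)[OF _ _ Cons, of "emb_U sU sV x"] show ?case
    by (simp add: primitive_gens_def emb_eq_jword jword_append)
qed

context
  fixes P assumes P: "laplace_pairing sU sV P"
begin

lemma laplace_jword:
  assumes "b \<in> carrier H" "c \<in> carrier H"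
  shows "P (jword sU sV u v, b \<otimes>\<^bsub>H\<^esub> c) = (\<Sum>(a, a')\<leftarrow>splits u. \<Sum>(e, e')\<leftarrow>splits v.
    P (jword sU sV a e, b) * P (jword sU sV a' e', c))"
  unfolding laplace_pairing_sweedler[OF P jword_closed assms]
  by (rule sweedler_comult_jword[OF laplace_integrand_bilinmap[OF laplace_pairing_bilinmap[OF P] assms]])

text \<open>As \<open>\<Delta>1 = 1 \<otimes> 1\<close>, pairing with \<open>1\<close> is multiplicative.\<close>

lemma laplace_one:
  assumes "b \<in> carrier H" "c \<in> carrier H"
  shows "P (\<one>\<^bsub>H\<^esub>, b \<otimes>\<^bsub>H\<^esub> c) = P (\<one>\<^bsub>H\<^esub>, b) * P (\<one>\<^bsub>H\<^esub>, c)"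
  unfolding jword_Nil laplace_jword[OF assms] by simp

text \<open>As \<open>\<Delta>g = 1 \<otimes> g + g \<otimes> 1\<close>, pairing with \<open>g\<close> is a derivation relative to pairing with \<open>1\<close>.\<close>

lemma laplace_primitive:
  assumes "g \<in> primitive_gens" "b \<in> carrier H" "c \<in> carrier H"
  shows "P (g, b \<otimes>\<^bsub>H\<^esub> c) = P (\<one>\<^bsub>H\<^esub>, b) * P (g, c) + P (g, b) * P (\<one>\<^bsub>H\<^esub>, c)"
  using assms(1) by (auto simp: primitive_gens_def emb_eq_jword jword_Nil laplace_jword[OF assms(2,3)])

end

text \<open>Two compatible pairings agree on \<open>(1|b)\<close>, then on \<open>(g|b)\<close> for generators \<open>g\<close>, in both cases by induction
  on \<open>b\<close> as a product of generators.  Agreement on \<open>(a|b)\<close> follows by induction on \<open>a\<close> as a product of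
  generators: symmetry moves \<open>ga\<close> into the second argument, where the Laplace identity splits it.\<close>

lemma laplace_pairing_unique:
  assumes P: "laplace_pairing sU sV P" "compatible_with sU sV d P"
    and Q: "laplace_pairing sU sV Q" "compatible_with sU sV d Q"
  shows "P = Q"
proof -
  note Pb = laplace_pairing_bilinmap[OF P(1)] and Qb = laplace_pairing_bilinmap[OF Q(1)]
  have one: "P (\<one>\<^bsub>H\<^esub>, \<one>\<^bsub>H\<^esub>) = Q (\<one>\<^bsub>H\<^esub>, \<one>\<^bsub>H\<^esub>)"
    and one_gen: "\<And>g. g \<in> primitive_gens \<Longrightarrow> P (\<one>\<^bsub>H\<^esub>, g) = Q (\<one>\<^bsub>H\<^esub>, g)"
    and gen_one: "\<And>g. g \<in> primitive_gens \<Longrightarrow> P (g, \<one>\<^bsub>H\<^esub>) = Q (g, \<one>\<^bsub>H\<^esub>)"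
    and gen_gen: "\<And>g h. g \<in> primitive_gens \<Longrightarrow> h \<in> primitive_gens \<Longrightarrow> P (g, h) = Q (g, h)"
    using P(2) Q(2) by (auto simp: compatible_with_def Let_def primitive_gens_def)
  have one_eq: "P (\<one>\<^bsub>H\<^esub>, b) = Q (\<one>\<^bsub>H\<^esub>, b)" if "b \<in> carrier H" for b
  proof (rule linmap_joint_eqI[OF bilinmap_right[OF Pb] bilinmap_right[OF Qb] _ that])
    fix u v
    show "P (\<one>\<^bsub>H\<^esub>, jword sU sV u v) = Q (\<one>\<^bsub>H\<^esub>, jword sU sV u v)"
      by (induction rule: jword_gens_induct)
         (simp_all add: one one_gen laplace_one[OF P(1)] laplace_one[OF Q(1)] primitive_gens_closed)
  qed simp_all
  have gen_eq: "P (g, b) = Q (g, b)" if g: "g \<in> primitive_gens" and b: "b \<in> carrier H" for g b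
  proof (rule linmap_joint_eqI[OF bilinmap_right[OF Pb] bilinmap_right[OF Qb] _ b])
    fix u v
    show "P (g, jword sU sV u v) = Q (g, jword sU sV u v)"
      by (induction rule: jword_gens_induct)
         (simp_all add: g one_eq gen_one gen_gen laplace_primitive[OF P(1)] laplace_primitive[OF Q(1)] primitive_gens_closed)
  qed (simp_all add: primitive_gens_closed g)
  have word_eq: "P (jword sU sV u v, b) = Q (jword sU sV u v, b)" if "b \<in> carrier H" for u v b
    using that
  proof (induction arbitrary: b rule: jword_gens_induct)
    case one
    then show ?case by (rule one_eq)
  next
    case (gen g X)
    have g: "g \<in> carrier H" by (rule primitive_gens_closed) fact
    have "P (g \<otimes>\<^bsub>H\<^esub> X, b) = P (b, g \<otimes>\<^bsub>H\<^esub> X)"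
      by (rule laplace_pairing_sym[OF P(1)]) (simp_all add: g gen)
    also have "\<dots> = sweedler scalars (\<lambda>a1 a2. P (a1, g) * P (a2, X)) (comult_joint sU sV b)"
      by (rule laplace_pairing_sweedler[OF P(1)]) (simp_all add: g gen)
    also have "\<dots> = sweedler scalars (\<lambda>a1 a2. Q (a1, g) * Q (a2, X)) (comult_joint sU sV b)"
    proof (rule sweedler_cong[OF kalg_joint kalg_joint kspace_scalars laplace_integrand_bilinmap[OF Pb g]])
      fix a1 a2 assume a: "a1 \<in> carrier H" "a2 \<in> carrier H"
      have "P (a1, g) = Q (a1, g)"
        using gen_eq[OF gen(1) a(1)]
        by (simp add: laplace_pairing_sym[OF P(1) a(1) g] laplace_pairing_sym[OF Q(1) a(1) g])
      moreover have "P (a2, X) = Q (a2, X)"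
        using gen(3)[OF a(2)] gen(2)
        by (simp add: laplace_pairing_sym[OF P(1) a(2)] laplace_pairing_sym[OF Q(1) a(2)])
      ultimately show "P (a1, g) * P (a2, X) = Q (a1, g) * Q (a2, X)" by simp
    qed (use gen linmap_closed[OF comult_joint_linmap] in auto)
    also have "\<dots> = Q (b, g \<otimes>\<^bsub>H\<^esub> X)"
      by (rule laplace_pairing_sweedler[OF Q(1), symmetric]) (simp_all add: g gen)
    also have "\<dots> = Q (g \<otimes>\<^bsub>H\<^esub> X, b)"
      by (rule laplace_pairing_sym[OF Q(1)]) (simp_all add: g gen)
    finally show ?case .
  qed
  have all_eq: "P (a, b) = Q (a, b)" if "a \<in> carrier H" "b \<in> carrier H" for a b
    by (rule linmap_joint_eqI[OF bilinmap_left[OF Pb] bilinmap_left[OF Qb] word_eq]) (use that in auto)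
  show "P = Q"
  proof (rule extensionalityI)
    show "P \<in> extensional (carrier H \<times> carrier H)" "Q \<in> extensional (carrier H \<times> carrier H)"
      using P(1) Q(1) by (simp_all add: laplace_pairing_def bilinear_form_def Let_def)
  qed (auto simp: all_eq)
qed

end

section \<open>Existence and uniqueness of the Laplace pairing\<close>

theorem theorem3p1:
  fixes scaleU :: "'k::real_normed_field \<Rightarrow> 'u::ab_group_add \<Rightarrow> 'u"
    and scaleV :: "'k \<Rightarrow> 'v::ab_group_add \<Rightarrow> 'v"
    and duality :: "'u \<Rightarrow> 'v \<Rightarrow> 'k"
  assumes "vector_space scaleU"
    and "vector_space scaleV"
    and "\<And>y. Vector_Spaces.linear scaleU (*) (\<lambda>x. duality x y)"
    and "\<And>x. Vector_Spaces.linear scaleV (*) (\<lambda>y. duality x y)"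
  shows "(\<exists>!P. laplace_pairing scaleU scaleV P \<and> compatible_with scaleU scaleV duality P) \<and>
    (\<forall>P. laplace_pairing scaleU scaleV P \<and> compatible_with scaleU scaleV duality P \<longrightarrow>
      (\<forall>a\<in>carrier (joint_algebra scaleU scaleV). \<forall>b\<in>carrier (joint_algebra scaleU scaleV).
        P (a, b) = P (b, a)))"
proof (intro conjI allI impI ballI)
  have "\<exists>P. laplace_pairing scaleU scaleV P \<and> compatible_with scaleU scaleV duality P"
    by (rule duality_form.laplace_pairing_exists, unfold_locales)
       (use assms(3,4) in \<open>simp_all add: Vector_Spaces.linear_iff\<close>)
  then show "\<exists>!P. laplace_pairing scaleU scaleV P \<and> compatible_with scaleU scaleV duality P"
    using joint_tensor_algebra.laplace_pairing_unique by blast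
qed (auto intro: joint_tensor_algebra.laplace_pairing_sym)

end
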